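(* Let $n\ge 3$ and let $G=\langle a, b\mid a^n=b^2=1, bab=a^{-1}\rangle$ be the dihedral group $D_{2n}$ of order $2n\geq 6$. Let $C\in\mathcal{T}(G)$, $A_0=\mathrm{Aut}(G;C)$, and $A_0\cap\langle\varphi\rangle=\langle\varphi^r\rangle$, where $r$ is a positive divisor of $n$. (a) There exists a non-empty subset $I\subseteq\{0,1,\dots,r-1\}$ such that $C=\bigcup_{i\in I} ba^i\langle a^r\rangle$, and $A_0/\langle\varphi^r\rangle$ acts transitively on the set $\mathcal{S}=\{ba^i\langle a^r\rangle\mid i\in I\}$. (b) Up to replacing $C$ by $C^\sigma$ (which again lies in $\mathcal{T}(G)$) for some $\sigma\in\mathrm{Aut}(G)$, we may assume that $0\in I$. (c) If $I=\{0\}$, then $r=1$, $C=\{ba^i\mid 0\leq i\leq n-1\}$ is the set of all non-central involutions of $G$ of this form, and $A_0=\mathrm{Aut}(G)$. (d) If $I=\{0,i\}$ for some $i\neq 0$, then $\gcd(i,r)=1$, there exists a positive integer $k<n$ such that $\gcd(k,n)=1$ and $r\mid (k+1)$, and $C=b\langle a^r\rangle\cup ba^i\langle a^r\rangle$ with $\langle\varphi^r,\tau_k\varphi^i\rangle$ a subgroup of $A_0$ acting transitively on $C$. In particular, if $r=n$, then for some $\sigma\in\mathrm{Aut}(G)$, $C^\sigma=\{b,ba\}$, with $A_0^\sigma=\langle\tau_{n-1}\varphi\rangle\cong\mathbb{Z}_2$.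
   Context: Maps are written as exponents and composed from left to right; $A_0^\sigma=\sigma^{-1}A_0\sigma=\mathrm{Aut}(G;C^\sigma)$. For $G=\langle a,b\rangle\cong D_{2n}$ as in the claim, define automorphisms $\varphi: a\mapsto a,\ b\mapsto ba$ and, for each positive integer $k<n$ with $\gcd(k,n)=1$, $\tau_k: a\mapsto a^k,\ b\mapsto b$. Then $\mathrm{Aut}(G)=\langle\varphi\rangle\rtimes T$, where $\langle\varphi\rangle\cong\mathbb{Z}_n$ and $T=\{\tau_k\mid 1\leq k\leq n-1,\gcd(k,n)=1\}$, and $(a^i)^{\tau_k\varphi^j}=a^{ik}$, $(ba^i)^{\tau_k\varphi^j}=ba^{ik+j}$. For a nontrivial finite group $G$, an inverse-closed generating set is a non-empty subset $C\subseteq G\setminus\{1\}$ with $\langle C\rangle=G$ and $c^{-1}\in C$ for all $c\in C$; $\mathrm{Aut}(G;C)=\{\sigma\in\mathrm{Aut}(G)\mid C^\sigma=C\}$. Such $C$ is called transitive if either $\mathrm{Aut}(G;C)$ is transitive on $C$, or $\mathrm{Aut}(G;C)$ has exactly two orbits $C_+$ and $C_-$ on $C$ and $C_-=\{c^{-1}\mid c\in C_+\}$. $\mathcal{T}(G)$ denotes the set of all transitive inverse-closed generating sets for $G$. *)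

theory Defs
  imports "HOL-Algebra.Group_Action" "HOL-Algebra.Elementary_Groups"
    "HOL-Algebra.Multiplicative_Group" "HOL-Number_Theory.Cong"
begin

section \<open>Dihedral groups\<close>

text \<open>
  The relations of the presentation together with the order characterise the presented group
  up to isomorphism: see \<open>dihedral_universal\<close> (the universal property of the
  presentation) and \<open>dihedral_exists\<close> below.
\<close>

locale dihedral_group = group G for G (structure) +
  fixes n :: nat and a b
  assumes a_closed: "a \<in> carrier G"
    and b_closed: "b \<in> carrier G"
    and generated: "generate G {a, b} = carrier G"
    and a_pow_n: "a [^] n = \<one>"
    and b_pow_2: "b [^] (2::nat) = \<one>"
    and bab: "b \<otimes> a \<otimes> b = inv a"
    and order_eq: "order G = 2 * n"

lemma (in group) dihedral_commute:
  fixes n i t :: nat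
  assumes x: "x \<in> carrier G" and y: "y \<in> carrier G" and n: "n > 0"
    and xn: "x [^] n = \<one>" and y2: "y [^] (2::nat) = \<one>" and yxy: "y \<otimes> x \<otimes> y = inv x"
  shows "x [^] i \<otimes> y [^] t = y [^] t \<otimes> x [^] ((n - 1) ^ t * i)"
proof -
  have inv_x: "inv x = x [^] (n - 1)"
    using n x xn by (intro inv_equality) (simp_all flip: nat_pow_Suc)
  have yy: "y \<otimes> y = \<one>" using y2 y by (simp add: numeral_2_eq_2)
  have 1: "x \<otimes> y = y \<otimes> x [^] (n - 1)"
  proof -
    have "y \<otimes> (y \<otimes> x \<otimes> y) = (y \<otimes> y) \<otimes> (x \<otimes> y)" using x y by (simp add: m_assoc)
    then show ?thesis using yy x y yxy inv_x by simp
  qed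
  have 2: "x [^] i \<otimes> y = y \<otimes> x [^] ((n - 1) * i)" for i :: nat
  proof (induction i)
    case 0
    then show ?case using y by simp
  next
    case (Suc i)
    have "x [^] Suc i \<otimes> y = x [^] i \<otimes> (x \<otimes> y)" using x y by (simp add: m_assoc)
    also have "\<dots> = (x [^] i \<otimes> y) \<otimes> x [^] (n - 1)" using x y 1 by (simp add: m_assoc)
    also have "\<dots> = y \<otimes> x [^] ((n - 1) * i + (n - 1))"
      using x y Suc by (simp add: m_assoc nat_pow_mult)
    finally show ?case by (simp add: add.commute)
  qed
  show ?thesis
  proof (induction t)
    case 0
    then show ?case using x by simp
  next
    case (Suc t)
    have "x [^] i \<otimes> y [^] Suc t = (x [^] i \<otimes> y [^] t) \<otimes> y" using x y by (simp add: m_assoc)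
    also have "\<dots> = y [^] t \<otimes> (x [^] ((n - 1) ^ t * i) \<otimes> y)" using x y Suc by (simp add: m_assoc)
    also have "\<dots> = y [^] Suc t \<otimes> x [^] ((n - 1) ^ Suc t * i)"
      using x y 2 by (simp add: m_assoc mult.assoc)
    finally show ?case .
  qed
qed

lemma (in group) dihedral_mult:
  fixes n i j s t :: nat
  assumes "x \<in> carrier G" "y \<in> carrier G" "n > 0"
    and "x [^] n = \<one>" "y [^] (2::nat) = \<one>" "y \<otimes> x \<otimes> y = inv x"
  shows "(y [^] s \<otimes> x [^] i) \<otimes> (y [^] t \<otimes> x [^] j)
       = y [^] (s + t) \<otimes> x [^] ((n - 1) ^ t * i + j)"
proof -
  have "(y [^] s \<otimes> x [^] i) \<otimes> (y [^] t \<otimes> x [^] j) = y [^] s \<otimes> (x [^] i \<otimes> y [^] t) \<otimes> x [^] j"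
    using assms by (simp add: m_assoc)
  also have "\<dots> = y [^] s \<otimes> (y [^] t \<otimes> x [^] ((n - 1) ^ t * i)) \<otimes> x [^] j"
    using dihedral_commute[OF assms] by simp
  also have "\<dots> = (y [^] s \<otimes> y [^] t) \<otimes> (x [^] ((n - 1) ^ t * i) \<otimes> x [^] j)"
    using assms by (simp add: m_assoc)
  finally show ?thesis using assms by (simp add: nat_pow_mult)
qed

lemma (in group) pow_mod_eq:
  fixes m i :: nat
  assumes "x \<in> carrier G" "x [^] m = \<one>"
  shows "x [^] (i mod m) = x [^] i"
proof -
  have "x [^] i = x [^] (m * (i div m) + i mod m)" by simp
  also have "\<dots> = x [^] (m * (i div m)) \<otimes> x [^] (i mod m)"
    using assms by (simp only: nat_pow_mult)
  also have "x [^] (m * (i div m)) = \<one>" using assms by (simp flip: nat_pow_pow)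
  finally show ?thesis using assms by simp
qed

lemma (in dihedral_group) normal_form:
  assumes n: "n > 0"
  shows "bij_betw (\<lambda>(s, i). b [^] s \<otimes> a [^] i) ({..<2::nat} \<times> {..<n}) (carrier G)"
proof -
  let ?f = "\<lambda>(s::nat, i::nat). b [^] s \<otimes> a [^] i" and ?D = "{..<2::nat} \<times> {..<n}"
  note mlt = dihedral_mult[OF a_closed b_closed n a_pow_n b_pow_2 bab]
  have img: "b [^] s \<otimes> a [^] i \<in> ?f ` ?D" for s i :: nat
  proof (rule image_eqI)
    show "b [^] s \<otimes> a [^] i = ?f (s mod 2, i mod n)"
      using pow_mod_eq[OF a_closed a_pow_n, of i] pow_mod_eq[OF b_closed b_pow_2, of s] by simp
    show "(s mod 2, i mod n) \<in> ?D" using n by simp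
  qed
  have gens: "a \<in> ?f ` ?D" "b \<in> ?f ` ?D"
    using img[of 0 1] img[of 1 0] a_closed b_closed by simp_all
  have "g \<in> ?f ` ?D" if "g \<in> generate G {a, b}" for g
    using that
  proof (induction rule: generate.induct)
    case one
    show ?case using img[of 0 0] by simp
  next
    case (incl h)
    then show ?case using gens by blast
  next
    case (inv h)
    have "inv a = a [^] (n - 1)"
      using n a_closed a_pow_n by (intro inv_equality) (simp_all flip: nat_pow_Suc)
    moreover have "inv b = b"
      using b_closed b_pow_2 by (intro inv_equality) (simp_all add: numeral_2_eq_2)
    ultimately show ?case
      using inv gens img[of 0 "n - 1"] a_closed by force
  next
    case (eng g h)
    then obtain s i t j where "g = b [^] (s::nat) \<otimes> a [^] (i::nat)" "h = b [^] (t::nat) \<otimes> a [^] (j::nat)"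
      by auto
    then show ?case using mlt img by simp
  qed
  then have "carrier G \<subseteq> ?f ` ?D" using generated by auto
  moreover have "?f ` ?D \<subseteq> carrier G" using a_closed b_closed by auto
  ultimately have eq: "?f ` ?D = carrier G" by blast
  moreover have "card ?D = card (carrier G)" using order_eq by (simp add: order_def)
  ultimately have "inj_on ?f ?D" by (intro eq_card_imp_inj_on) auto
  with eq show ?thesis by (simp add: bij_betw_def)
qed

lemma (in dihedral_group) dihedral_universal:
  assumes n: "n > 0" and H: "group H" and x: "x \<in> carrier H" and y: "y \<in> carrier H"
    and rel: "x [^]\<^bsub>H\<^esub> n = \<one>\<^bsub>H\<^esub>" "y [^]\<^bsub>H\<^esub> (2::nat) = \<one>\<^bsub>H\<^esub>"
      "y \<otimes>\<^bsub>H\<^esub> x \<otimes>\<^bsub>H\<^esub> y = inv\<^bsub>H\<^esub> x"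
  shows "\<exists>!h. h \<in> hom G H \<inter> extensional (carrier G) \<and> h a = x \<and> h b = y"
proof -
  interpret H: group H by (rule H)
  let ?f = "\<lambda>(s::nat, i::nat). b [^] s \<otimes> a [^] i" and ?D = "{..<2::nat} \<times> {..<n}"
  note bij = normal_form[OF n]
  note mG = dihedral_mult[OF a_closed b_closed n a_pow_n b_pow_2 bab]
  note mH = H.dihedral_mult[OF x y n rel]
  have nf: "\<exists>s i. g = b [^] (s::nat) \<otimes> a [^] (i::nat)" if "g \<in> carrier G" for g
    using that bij_betw_imp_surj_on[OF bij] by fastforce
  define h where "h = (\<lambda>g\<in>carrier G. case inv_into ?D ?f g of (s, i) \<Rightarrow>
    y [^]\<^bsub>H\<^esub> s \<otimes>\<^bsub>H\<^esub> x [^]\<^bsub>H\<^esub> i)"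
  have h: "h (b [^] s \<otimes> a [^] i) = y [^]\<^bsub>H\<^esub> s \<otimes>\<^bsub>H\<^esub> x [^]\<^bsub>H\<^esub> i" for s i :: nat
  proof -
    have "?f (s mod 2, i mod n) = b [^] s \<otimes> a [^] i"
      using pow_mod_eq[OF a_closed a_pow_n, of i] pow_mod_eq[OF b_closed b_pow_2, of s] by simp
    moreover have "(s mod 2, i mod n) \<in> ?D" using n by simp
    ultimately have "inv_into ?D ?f (b [^] s \<otimes> a [^] i) = (s mod 2, i mod n)"
      using bij_betw_imp_inj_on[OF bij] by (metis (no_types, lifting) inv_into_f_f)
    then show ?thesis
      using a_closed b_closed H.pow_mod_eq[OF x rel(1), of i] H.pow_mod_eq[OF y rel(2), of s]
      by (simp add: h_def)
  qed
  have hom: "h \<in> hom G H"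
  proof (rule homI)
    fix g assume "g \<in> carrier G"
    then show "h g \<in> carrier H" using nf[of g] h x y by auto
  next
    fix g k assume "g \<in> carrier G" "k \<in> carrier G"
    then obtain s i t j where "g = b [^] (s::nat) \<otimes> a [^] (i::nat)" "k = b [^] (t::nat) \<otimes> a [^] (j::nat)"
      using nf by metis
    then show "h (g \<otimes> k) = h g \<otimes>\<^bsub>H\<^esub> h k" by (simp add: mG mH h)
  qed
  have "h a = x" using h[of 0 1] a_closed x by simp
  moreover have "h b = y" using h[of 1 0] b_closed y by simp
  moreover have "h' = h" if h': "h' \<in> hom G H \<inter> extensional (carrier G)" "h' a = x" "h' b = y" for h'
  proof (rule extensionalityI[of _ "carrier G"])
    interpret h': group_hom G H h' using h' by unfold_locales auto
    fix g assume "g \<in> carrier G"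
    then obtain s i where g: "g = b [^] (s::nat) \<otimes> a [^] (i::nat)" using nf by metis
    show "h' g = h g"
      using h' a_closed b_closed by (simp add: g h h'.hom_nat_pow)
  qed (use h' in \<open>auto simp: h_def\<close>)
  ultimately show ?thesis using hom by (intro ex1I[of _ h]) (auto simp: h_def)
qed

lemma (in dihedral_group) dihedral_auto_ex1:
  assumes n: "n > 0" and k: "coprime k n"
  shows "\<exists>!\<sigma>. \<sigma> \<in> auto G \<and> \<sigma> a = a [^] (k::nat) \<and> \<sigma> b = b \<otimes> a [^] (j::nat)"
proof -
  note m = dihedral_mult[OF a_closed b_closed n a_pow_n b_pow_2 bab]
  have c: "a [^] k \<in> carrier G" "b \<otimes> a [^] j \<in> carrier G" using a_closed b_closed by auto
  have an: "a [^] (n * i) = \<one>" for i :: nat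
    using a_closed a_pow_n by (simp flip: nat_pow_pow)
  have b0: "b [^] (0::nat) = \<one>" and b1: "b [^] (1::nat) = b" using b_closed by simp_all
  have n1: "(n - 1) * i + i = n * i" for i :: nat
    using n by (metis Suc_diff_1 add.commute mult_Suc)
  have r1: "(a [^] k) [^] n = \<one>"
    using a_closed an[of k] by (simp add: nat_pow_pow mult.commute)
  have r2: "(b \<otimes> a [^] j) [^] (2::nat) = \<one>"
    using m[of 1 j 1 j] c an[of j] b_pow_2 n1[of j] b1 by (simp add: numeral_2_eq_2)
  have r3: "b \<otimes> a [^] j \<otimes> a [^] k \<otimes> (b \<otimes> a [^] j) = inv (a [^] k)"
  proof (rule inv_equality[symmetric])
    have e: "b \<otimes> a [^] j \<otimes> a [^] k = b [^] (1::nat) \<otimes> a [^] (j + k)"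
      using a_closed b_closed by (simp add: m_assoc nat_pow_mult)
    have "b \<otimes> a [^] j \<otimes> a [^] k \<otimes> (b \<otimes> a [^] j) \<otimes> a [^] k
        = (b [^] (1::nat) \<otimes> a [^] (j + k)) \<otimes> (b [^] (1::nat) \<otimes> a [^] (j + k))"
      using a_closed b_closed by (simp add: m_assoc nat_pow_mult)
    also have "\<dots> = \<one>" 
      using m[of 1 "j + k" 1 "j + k"] an[of "j + k"] b_pow_2 n1[of "j + k"] by (simp add: numeral_2_eq_2)
    finally show "b \<otimes> a [^] j \<otimes> a [^] k \<otimes> (b \<otimes> a [^] j) \<otimes> a [^] k = \<one>" .
  qed (use a_closed b_closed in auto)
  from dihedral_universal[OF n is_group c r1 r2 r3]
  obtain h where h: "h \<in> hom G G \<inter> extensional (carrier G)" "h a = a [^] k" "h b = b \<otimes> a [^] j"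
    and uniq: "\<And>h'. h' \<in> hom G G \<inter> extensional (carrier G) \<Longrightarrow> h' a = a [^] k \<Longrightarrow>
      h' b = b \<otimes> a [^] j \<Longrightarrow> h' = h"
    by (elim ex1E) blast
  interpret h: group_hom G G h using h by unfold_locales auto
  interpret im: subgroup "h ` carrier G" G by (rule h.img_is_subgroup)
  obtain l where l: "[k * l = 1] (mod n)" using k cong_solve_coprime_nat by (metis One_nat_def)
  have "(a [^] k) [^] l = a"
  proof -
    have "a [^] (k * l) = a [^] (1::nat)"
      using l pow_mod_eq[OF a_closed a_pow_n] unfolding cong_def by metis
    then show ?thesis using a_closed by (simp add: nat_pow_pow)
  qed
  then have "h (a [^] l) = a" using h a_closed by (simp add: h.hom_nat_pow)
  then have a_im: "a \<in> h ` carrier G" using a_closed by (metis image_eqI nat_pow_closed)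
  have "h (b \<otimes> inv ((a [^] l) [^] j)) = b"
    using \<open>h (a [^] l) = a\<close> h a_closed b_closed
    by (simp add: h.hom_nat_pow m_assoc)
  then have b_im: "b \<in> h ` carrier G" using a_closed b_closed
    by (metis image_eqI nat_pow_closed inv_closed m_closed)
  have "carrier G \<subseteq> h ` carrier G"
    using a_im b_im generated generate_subgroup_incl[OF _ h.img_is_subgroup, of "{a, b}"] by simp
  then have "h ` carrier G = carrier G" by (auto simp: h.hom_closed)
  moreover have "finite (carrier G)"
    using order_eq n by (auto simp: order_def intro: card_ge_0_finite)
  ultimately have "bij_betw h (carrier G) (carrier G)"
    by (metis bij_betw_def eq_card_imp_inj_on)
  then have "h \<in> auto G" using h by (auto simp: auto_def Bij_def)
  then show ?thesis using h uniq by (intro ex1I[of _ h]) (auto simp: auto_def Bij_def)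
qed

lemma dihedral_exists:
  assumes n: "n > 0"
  shows "\<exists>(G :: (nat \<times> nat) monoid) a b. dihedral_group G n a b"
proof -
  define G :: "(nat \<times> nat) monoid" where
    "G = \<lparr>carrier = {..<2} \<times> {..<n},
          monoid.mult = (\<lambda>(s, i) (t, j). ((s + t) mod 2, ((n - 1) ^ t * i + j) mod n)),
          one = (0, 0)\<rparr>"
  have sq: "((n - 1) * (n - 1) * k) mod n = k mod n" for k
  proof -
    obtain m where m: "n = Suc m" using n by (metis Suc_diff_1)
    have "int ((n - 1) * (n - 1) * k) = int k + int n * ((int n - 2) * int k)"
      by (simp add: m algebra_simps)
    then have "int ((n - 1) * (n - 1) * k) mod int n = int k mod int n" by simp
    then show ?thesis by (metis of_nat_eq_iff of_nat_mod)
  qed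
  have par: "((n - 1) ^ (t mod 2) * k) mod n = ((n - 1) ^ t * k) mod n" for t k
  proof (induction t rule: less_induct)
    case (less t)
    show ?case
    proof (cases "t < 2")
      case False
      then obtain u where t: "t = u + 2" by (metis add.commute le_add_diff_inverse not_less)
      have "((n - 1) ^ t * k) mod n = ((n - 1) ^ u * k) mod n"
        using sq[of "(n - 1) ^ u * k"] by (simp add: t mult.assoc)
      then show ?thesis using less[of u] t by simp
    qed simp
  qed
  have grp: "group G"
  proof (rule groupI)
    fix g h k assume "g \<in> carrier G" "h \<in> carrier G" "k \<in> carrier G"
    obtain s i t j u l where e: "g = (s, i)" "h = (t, j)" "k = (u, l)" by (metis surj_pair)
    have "((n - 1) ^ u * (((n - 1) ^ t * i + j) mod n) + l) mod n
        = ((n - 1) ^ u * ((n - 1) ^ t * i + j) + l) mod n"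
      by (metis mod_add_left_eq mod_mult_right_eq)
    moreover have "((n - 1) ^ ((t + u) mod 2) * i + ((n - 1) ^ u * j + l) mod n) mod n
        = ((n - 1) ^ (t + u) * i + ((n - 1) ^ u * j + l)) mod n"
      by (metis mod_add_left_eq mod_add_right_eq par)
    ultimately show "g \<otimes>\<^bsub>G\<^esub> h \<otimes>\<^bsub>G\<^esub> k = g \<otimes>\<^bsub>G\<^esub> (h \<otimes>\<^bsub>G\<^esub> k)"
      by (simp add: e G_def mod_simps add.assoc algebra_simps power_add)
  next
    fix g assume g: "g \<in> carrier G"
    then obtain s i where e: "g = (s, i)" "s < 2" "i < n" by (auto simp: G_def)
    show "\<exists>h\<in>carrier G. h \<otimes>\<^bsub>G\<^esub> g = \<one>\<^bsub>G\<^esub>"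
    proof (cases "s = 0")
      case True
      then show ?thesis using e n
        by (intro bexI[of _ "(0, (n - i) mod n)"]) (auto simp: G_def mod_simps)
    next
      case False
      then have s: "s = 1" using e by simp
      have "((n - 1) * i + i) mod n = 0"
        using n by (metis Suc_diff_1 add.commute mod_mult_self1_is_0 mult_Suc)
      then show ?thesis using e s
        by (intro bexI[of _ g]) (auto simp: G_def)
    qed
  qed (use n in \<open>auto simp: G_def\<close>)
  then interpret group G .
  let ?a = "(0, 1 mod n)" and ?b = "(1, 0)"
  have pow_a: "?a [^]\<^bsub>G\<^esub> i = (0, i mod n)" for i :: nat
    by (induction i) (auto simp: G_def mod_simps)
  have cl: "?a \<in> carrier G" "?b \<in> carrier G" using n by (auto simp: G_def)
  have el: "(s, i) = ?b [^]\<^bsub>G\<^esub> s \<otimes>\<^bsub>G\<^esub> ?a [^]\<^bsub>G\<^esub> i" if "s < 2" "i < n" for s i :: nat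
  proof -
    have "s = 0 \<or> s = 1" using that by auto
    then have "?b [^]\<^bsub>G\<^esub> s = (s, 0)" using cl by (auto simp: G_def nat_pow_def)
    then show ?thesis unfolding pow_a using that by (auto simp: G_def)
  qed
  have gen_pow: "x [^]\<^bsub>G\<^esub> i \<in> generate G {?a, ?b}" if "x \<in> {?a, ?b}" for x and i :: nat
    by (induction i) (simp_all only: nat_pow_0 nat_pow_Suc, rule generate.one,
      erule generate.eng, rule generate.incl[OF that])
  have "dihedral_group G n ?a ?b"
  proof unfold_locales
    show "generate G {?a, ?b} = carrier G"
    proof (rule equalityI)
      show "generate G {?a, ?b} \<subseteq> carrier G" using cl by (intro generate_incl) auto
      show "carrier G \<subseteq> generate G {?a, ?b}"
      proof
        fix g assume "g \<in> carrier G"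
        then obtain s i where "g = (s, i)" "s < 2" "i < n" by (auto simp: G_def)
        then show "g \<in> generate G {?a, ?b}"
          by (simp only: el[OF \<open>s < 2\<close> \<open>i < n\<close>]) (intro generate.eng gen_pow; simp)
      qed
    qed
    show "?a [^]\<^bsub>G\<^esub> n = \<one>\<^bsub>G\<^esub>" unfolding pow_a by (simp add: G_def)
    show "?b [^]\<^bsub>G\<^esub> (2::nat) = \<one>\<^bsub>G\<^esub>"
      using n by (simp add: numeral_2_eq_2 nat_pow_def) (simp add: G_def)
    show "?b \<otimes>\<^bsub>G\<^esub> ?a \<otimes>\<^bsub>G\<^esub> ?b = inv\<^bsub>G\<^esub> ?a"
    proof (rule inv_equality[symmetric])
      have "((n - 1) * (1 mod n) + 1 mod n) mod n = 0"
        using n by (metis Suc_diff_1 add.commute mod_mult_self1_is_0 mult_Suc)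
      then show "?b \<otimes>\<^bsub>G\<^esub> ?a \<otimes>\<^bsub>G\<^esub> ?b \<otimes>\<^bsub>G\<^esub> ?a = \<one>\<^bsub>G\<^esub>"
        by (auto simp: G_def mod_simps)
    qed (use cl in auto)
    show "order G = 2 * n" by (simp add: order_def G_def)
  qed (use cl in auto)
  then show ?thesis by blast
qed


section \<open>Automorphisms\<close>

text \<open>
  Following the convention that automorphisms act on the right, the product \<open>\<sigma>\<tau>\<close> applies \<open>\<sigma>\<close>
  first, whereas multiplication in \<^const>\<open>AutoGroup\<close> is ordinary composition.  The two groups are
  opposite to each other: subgroups, generated subgroups, powers and orbits coincide, and only
  products of two different automorphisms have to be reversed, which \<open>aut_then\<close> does.
  Accordingly \<open>aut_conj G A \<sigma>\<close> is \<open>A\<^sup>\<sigma> = inv \<sigma> \<cdot> A \<cdot> \<sigma>\<close>.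
\<close>

definition aut_then :: "('a, 'm) monoid_scheme \<Rightarrow> ('a \<Rightarrow> 'a) \<Rightarrow> ('a \<Rightarrow> 'a) \<Rightarrow> ('a \<Rightarrow> 'a)" where
  "aut_then G \<sigma> \<tau> = \<tau> \<otimes>\<^bsub>AutoGroup G\<^esub> \<sigma>"

definition aut_conj :: "('a, 'm) monoid_scheme \<Rightarrow> ('a \<Rightarrow> 'a) set \<Rightarrow> ('a \<Rightarrow> 'a) \<Rightarrow> ('a \<Rightarrow> 'a) set" where
  "aut_conj G A \<sigma> = (\<lambda>\<alpha>. aut_then G (aut_then G (inv\<^bsub>AutoGroup G\<^esub> \<sigma>) \<alpha>) \<sigma>) ` A"

definition Aut_on :: "('a, 'm) monoid_scheme \<Rightarrow> 'a set \<Rightarrow> ('a \<Rightarrow> 'a) set" where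
  "Aut_on G C = {\<sigma> \<in> auto G. \<sigma> ` C = C}"

abbreviation aut_subgroup :: "('a, 'm) monoid_scheme \<Rightarrow> ('a \<Rightarrow> 'a) set \<Rightarrow> ('a \<Rightarrow> 'a) monoid" where
  "aut_subgroup G A \<equiv> (AutoGroup G)\<lparr>carrier := A\<rparr>"

text \<open>Restriction to \<open>E\<close> is needed because \<^const>\<open>BijGroup\<close> consists of extensional functions.\<close>

definition aut_transitive_on :: "('a, 'm) monoid_scheme \<Rightarrow> ('a \<Rightarrow> 'a) set \<Rightarrow> 'a set \<Rightarrow> bool" where
  "aut_transitive_on G A E \<longleftrightarrow> transitive_action (aut_subgroup G A) E (\<lambda>\<sigma>. restrict \<sigma> E)"

text \<open>
  \<open>A/N\<close> acts transitively on the family \<open>S\<close> of sets by the action \<open>N\<sigma> : E \<mapsto> E\<^sup>\<sigma>\<close> induced from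
  that of \<open>A\<close>; existence of \<open>\<psi>\<close> includes that this is well defined.
\<close>

definition aut_factor_transitive_on ::
  "('a, 'm) monoid_scheme \<Rightarrow> ('a \<Rightarrow> 'a) set \<Rightarrow> ('a \<Rightarrow> 'a) set \<Rightarrow> 'a set set \<Rightarrow> bool" where
  "aut_factor_transitive_on G A N S \<longleftrightarrow>
     N \<lhd> aut_subgroup G A \<and>
     (\<exists>\<psi>. transitive_action (aut_subgroup G A Mod N) S \<psi> \<and>
          (\<forall>\<sigma>\<in>A. \<forall>E\<in>S. \<psi> (N #>\<^bsub>aut_subgroup G A\<^esub> \<sigma>) E = \<sigma> ` E))"


section \<open>Transitive inverse-closed generating sets\<close>

definition inverse_closed_generating_set :: "('a, 'm) monoid_scheme \<Rightarrow> 'a set \<Rightarrow> bool" where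
  "inverse_closed_generating_set G C \<longleftrightarrow>
     C \<noteq> {} \<and> C \<subseteq> carrier G - {\<one>\<^bsub>G\<^esub>} \<and> generate G C = carrier G \<and> (\<forall>c\<in>C. inv\<^bsub>G\<^esub> c \<in> C)"

definition transitive_gensets :: "('a, 'm) monoid_scheme \<Rightarrow> 'a set set" where
  "transitive_gensets G =
     {C. inverse_closed_generating_set G C \<and>
         (aut_transitive_on G (Aut_on G C) C \<or>
          (\<exists>O1 O2. O1 \<noteq> O2 \<and>
             orbits (aut_subgroup G (Aut_on G C)) C (\<lambda>\<sigma>. \<sigma>) = {O1, O2} \<and>
             O2 = (\<lambda>c. inv\<^bsub>G\<^esub> c) ` O1))}"


section \<open>Automorphisms of dihedral groups\<close>

text \<open>Existence and uniqueness are the cases \<open>k = j = 1\<close> and \<open>j = 0\<close> of \<open>dihedral_auto_ex1\<close>.\<close>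

definition dihedral_phi :: "('a, 'm) monoid_scheme \<Rightarrow> 'a \<Rightarrow> 'a \<Rightarrow> ('a \<Rightarrow> 'a)" where
  "dihedral_phi G a b = (THE \<sigma>. \<sigma> \<in> auto G \<and> \<sigma> a = a \<and> \<sigma> b = b \<otimes>\<^bsub>G\<^esub> a)"

definition dihedral_tau :: "('a, 'm) monoid_scheme \<Rightarrow> 'a \<Rightarrow> 'a \<Rightarrow> nat \<Rightarrow> ('a \<Rightarrow> 'a)" where
  "dihedral_tau G a b k = (THE \<sigma>. \<sigma> \<in> auto G \<and> \<sigma> a = a [^]\<^bsub>G\<^esub> k \<and> \<sigma> b = b)"


section \<open>Unions of cosets of reflections\<close>

definition reflection_coset :: "('a, 'm) monoid_scheme \<Rightarrow> 'a \<Rightarrow> 'a \<Rightarrow> nat \<Rightarrow> nat \<Rightarrow> 'a set" where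
  "reflection_coset G a b r i = (b \<otimes>\<^bsub>G\<^esub> a [^]\<^bsub>G\<^esub> i) <#\<^bsub>G\<^esub> generate G {a [^]\<^bsub>G\<^esub> r}"

definition reflection_index_set ::
  "('a, 'm) monoid_scheme \<Rightarrow> 'a \<Rightarrow> 'a \<Rightarrow> nat \<Rightarrow> 'a set \<Rightarrow> nat set \<Rightarrow> bool" where
  "reflection_index_set G a b r C I \<longleftrightarrow>
     I \<noteq> {} \<and> I \<subseteq> {0..<r} \<and> C = (\<Union>i\<in>I. reflection_coset G a b r i)"

end

theory Submission
  imports Defs
begin

text \<open>
  For \<open>n \<ge> 3\<close> every automorphism has the form \<open>a \<mapsto> a\<^sup>k\<close>, \<open>b \<mapsto> ba\<^sup>j\<close>, so it preserves the set of
  reflections \<open>ba\<^sup>i\<close>.  A generating set contains a reflection, hence a transitive one consists of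
  reflections only.  Invariance under \<open>\<phi>\<^sup>r\<close> makes it a union of cosets of \<open>\<langle>a\<^sup>r\<rangle>\<close>, which the
  remaining automorphisms permute.  A set of reflections \<open>ba\<^sup>i\<close> with all \<open>i\<close> divisible by a divisor
  \<open>d > 1\<close> of \<open>n\<close> cannot generate; this gives \<open>r = 1\<close> for a single coset and \<open>gcd(i, r) = 1\<close> for
  two cosets.  In the latter case the automorphism moving \<open>b\<close> to \<open>ba\<^sup>i\<close> swaps the two cosets, which
  forces \<open>r\<close> to divide \<open>i(k + 1)\<close>.
\<close>

section \<open>Automorphisms acting on subsets of a group\<close>

text \<open>The bound \<open>n \<ge> 3\<close> is what separates rotations from reflections:
  \<open>a\<close> has order at least 3 while every reflection has order 2, and \<open>b\<close>
  cannot become a rotation because \<open>a\<close> and \<open>b\<close> do not commute.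
  Automorphisms then act on the exponents of reflections by affine maps i -> j + k i modulo
  \<open>n\<close> with \<open>k\<close> a unit. Since \<open>r\<close> divides \<open>n\<close>,
  these maps descend to permutations of the residues modulo \<open>r\<close>. Exponents are natural
  numbers, so \<open>n - 1\<close> plays the role of -1. The group generated by \<phi> is handled as
  the set of all automorphisms fixing \<open>a\<close>. In this form it is visibly normal, so its
  intersection with the stabiliser of \<open>C\<close> is normal in that stabiliser. It is also
  abelian, so moving \<open>C\<close> by one of its elements leaves the intersection, and with it
  \<open>r\<close>, unchanged; this is what claim (b) needs.\<close>

context group
begin

lemma carrier_AutoGroup [simp]: "carrier (AutoGroup G) = auto G"
  by (simp add: AutoGroup_def)

lemma AutoGroup_one: "\<one>\<^bsub>AutoGroup G\<^esub> = (\<lambda>x\<in>carrier G. x)"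
  by (simp add: AutoGroup_def BijGroup_def)

lemma AutoGroup_mult:
  assumes "\<sigma> \<in> auto G" "\<tau> \<in> auto G"
  shows "\<sigma> \<otimes>\<^bsub>AutoGroup G\<^esub> \<tau> = compose (carrier G) \<sigma> \<tau>"
  using assms by (simp add: AutoGroup_def BijGroup_def auto_def)

lemma auto_bij: "\<sigma> \<in> auto G \<Longrightarrow> bij_betw \<sigma> (carrier G) (carrier G)"
  by (simp add: auto_def Bij_def)

lemma auto_closed: "\<sigma> \<in> auto G \<Longrightarrow> x \<in> carrier G \<Longrightarrow> \<sigma> x \<in> carrier G"
  using auto_bij bij_betwE by blast

lemma auto_hom: "\<sigma> \<in> auto G \<Longrightarrow> group_hom G G \<sigma>"
  by (auto simp: auto_def group_hom_def group_hom_axioms_def)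

lemma AutoGroup_mult_apply:
  assumes "\<sigma> \<in> auto G" "\<tau> \<in> auto G" "x \<in> carrier G"
  shows "(\<sigma> \<otimes>\<^bsub>AutoGroup G\<^esub> \<tau>) x = \<sigma> (\<tau> x)"
  using assms by (simp add: AutoGroup_mult compose_def)

lemma AutoGroup_mult_image:
  assumes "\<sigma> \<in> auto G" "\<tau> \<in> auto G" "E \<subseteq> carrier G"
  shows "(\<sigma> \<otimes>\<^bsub>AutoGroup G\<^esub> \<tau>) ` E = \<sigma> ` \<tau> ` E"
  unfolding image_image using assms AutoGroup_mult_apply by (intro image_cong) auto

lemma AutoGroup_one_image: "E \<subseteq> carrier G \<Longrightarrow> \<one>\<^bsub>AutoGroup G\<^esub> ` E = E"
  by (auto simp: AutoGroup_one)

lemma AutoGroup_inv_closed: "\<sigma> \<in> auto G \<Longrightarrow> inv\<^bsub>AutoGroup G\<^esub> \<sigma> \<in> auto G"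
  using group.inv_closed[OF AutoGroup] by simp

lemma AutoGroup_mult_closed:
  "\<sigma> \<in> auto G \<Longrightarrow> \<tau> \<in> auto G \<Longrightarrow> \<sigma> \<otimes>\<^bsub>AutoGroup G\<^esub> \<tau> \<in> auto G"
  using monoid.m_closed[OF group.is_monoid[OF AutoGroup]] by simp

lemma AutoGroup_inv_apply:
  assumes "\<sigma> \<in> auto G" "x \<in> carrier G"
  shows "\<sigma> ((inv\<^bsub>AutoGroup G\<^esub> \<sigma>) x) = x" "(inv\<^bsub>AutoGroup G\<^esub> \<sigma>) (\<sigma> x) = x"
  using assms AutoGroup_mult_apply[of \<sigma> "inv\<^bsub>AutoGroup G\<^esub> \<sigma>" x]
    AutoGroup_mult_apply[of "inv\<^bsub>AutoGroup G\<^esub> \<sigma>" \<sigma> x] AutoGroup_inv_closed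
    group.r_inv[OF AutoGroup, of \<sigma>] group.l_inv[OF AutoGroup, of \<sigma>]
  by (simp_all add: AutoGroup_one)

lemma AutoGroup_inv_image:
  assumes "\<sigma> \<in> auto G" "E \<subseteq> carrier G"
  shows "\<sigma> ` (inv\<^bsub>AutoGroup G\<^esub> \<sigma>) ` E = E" "(inv\<^bsub>AutoGroup G\<^esub> \<sigma>) ` \<sigma> ` E = E"
proof -
  have "(\<lambda>x. \<sigma> ((inv\<^bsub>AutoGroup G\<^esub> \<sigma>) x)) ` E = (\<lambda>x. x) ` E"
    using assms by (intro image_cong refl AutoGroup_inv_apply) auto
  moreover have "(\<lambda>x. (inv\<^bsub>AutoGroup G\<^esub> \<sigma>) (\<sigma> x)) ` E = (\<lambda>x. x) ` E"
    using assms by (intro image_cong refl AutoGroup_inv_apply) auto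
  ultimately show "\<sigma> ` (inv\<^bsub>AutoGroup G\<^esub> \<sigma>) ` E = E" "(inv\<^bsub>AutoGroup G\<^esub> \<sigma>) ` \<sigma> ` E = E"
    unfolding image_image image_ident by -
qed

lemma auto_image_subset: "\<sigma> \<in> auto G \<Longrightarrow> E \<subseteq> carrier G \<Longrightarrow> \<sigma> ` E \<subseteq> carrier G"
  using auto_closed by blast

lemma subgroup_Aut_on:
  assumes "C \<subseteq> carrier G"
  shows "subgroup (Aut_on G C) (AutoGroup G)"
proof (rule group.subgroupI[OF AutoGroup])
  show "Aut_on G C \<noteq> {}"
    using id_in_auto AutoGroup_one_image[OF assms, unfolded AutoGroup_one]
    unfolding Aut_on_def by blast
  fix \<sigma> assume s: "\<sigma> \<in> Aut_on G C"
  then show "inv\<^bsub>AutoGroup G\<^esub> \<sigma> \<in> Aut_on G C"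
    using AutoGroup_inv_closed AutoGroup_inv_image[OF _ assms, of \<sigma>] by (auto simp: Aut_on_def)
  fix \<tau> assume "\<tau> \<in> Aut_on G C"
  with s show "\<sigma> \<otimes>\<^bsub>AutoGroup G\<^esub> \<tau> \<in> Aut_on G C"
    using AutoGroup_mult_closed AutoGroup_mult_image[OF _ _ assms] by (auto simp: Aut_on_def)
qed (auto simp: Aut_on_def)

text \<open>Since \<open>aut_then\<close> reverses products, the conjugate of \<alpha> is, as an
  ordinary composition, \<sigma> after \<alpha> after the inverse of \<sigma>. This is the usual
  transport of a stabiliser to the image set.\<close>

lemma aut_conj_Aut_on:
  assumes s: "\<sigma> \<in> auto G" and C: "C \<subseteq> carrier G"
  shows "aut_conj G (Aut_on G C) \<sigma> = Aut_on G (\<sigma> ` C)"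
proof -
  interpret A: group "AutoGroup G" by (rule AutoGroup)
  let ?s = "inv\<^bsub>AutoGroup G\<^esub> \<sigma>"
  have s': "?s \<in> auto G" using s by (rule AutoGroup_inv_closed)
  note [simp] = AutoGroup_mult_image AutoGroup_mult_closed AutoGroup_inv_image auto_image_subset
  show ?thesis
  proof (intro equalityI subsetI)
    fix \<beta> assume "\<beta> \<in> aut_conj G (Aut_on G C) \<sigma>"
    then obtain \<alpha> where a: "\<alpha> \<in> auto G" "\<alpha> ` C = C"
      and "\<beta> = \<sigma> \<otimes>\<^bsub>AutoGroup G\<^esub> (\<alpha> \<otimes>\<^bsub>AutoGroup G\<^esub> ?s)"
      by (auto simp: aut_conj_def aut_then_def Aut_on_def)
    then show "\<beta> \<in> Aut_on G (\<sigma> ` C)"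
      using s s' C by (simp add: Aut_on_def)
  next
    fix \<beta> assume b: "\<beta> \<in> Aut_on G (\<sigma> ` C)"
    \<comment> \<open>Conjugating \<beta> backwards gives the preimage.\<close>
    let ?\<alpha> = "?s \<otimes>\<^bsub>AutoGroup G\<^esub> (\<beta> \<otimes>\<^bsub>AutoGroup G\<^esub> \<sigma>)"
    have bb: "\<beta> \<in> auto G" using b by (simp add: Aut_on_def)
    have "\<sigma> \<otimes>\<^bsub>AutoGroup G\<^esub> (?s \<otimes>\<^bsub>AutoGroup G\<^esub> \<beta>) = \<beta>"
      using s s' bb by (simp flip: A.m_assoc)
    then have "\<beta> = \<sigma> \<otimes>\<^bsub>AutoGroup G\<^esub> (?\<alpha> \<otimes>\<^bsub>AutoGroup G\<^esub> ?s)"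
      using s s' bb by (simp add: A.m_assoc)
    moreover have "?\<alpha> \<in> Aut_on G C"
      using b s s' C by (simp add: Aut_on_def)
    ultimately show "\<beta> \<in> aut_conj G (Aut_on G C) \<sigma>"
      unfolding aut_conj_def aut_then_def by blast
  qed
qed

section \<open>Transitivity of the induced actions, in pointwise form\<close>

text \<open>Invariance of \<open>E\<close> makes every restriction a permutation of
  \<open>E\<close>, so the action axioms hold automatically and only the pointwise condition
  remains.\<close>

lemma aut_transitive_on_iff:
  assumes A: "subgroup A (AutoGroup G)" and E: "E \<subseteq> carrier G"
    and inv: "\<And>\<sigma>. \<sigma> \<in> A \<Longrightarrow> \<sigma> ` E = E"
  shows "aut_transitive_on G A E \<longleftrightarrow> (\<forall>x\<in>E. \<forall>y\<in>E. \<exists>\<sigma>\<in>A. \<sigma> x = y)"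
proof -
  have sub: "A \<subseteq> auto G" using subgroup.subset[OF A] by simp
  have bij: "restrict \<sigma> E \<in> Bij E" if "\<sigma> \<in> A" for \<sigma>
  proof -
    have "inj_on \<sigma> E"
      using auto_bij that sub E by (meson bij_betw_def inj_on_subset subsetD)
    then show ?thesis using inv[OF that] by (simp add: Bij_def bij_betw_def)
  qed
  have "group_action (aut_subgroup G A) E (\<lambda>\<sigma>. restrict \<sigma> E)"
  proof (intro group_action.intro group_hom.intro group_hom_axioms.intro homI)
    show "group (aut_subgroup G A)"
      using A AutoGroup by (rule subgroup.subgroup_is_group)
    show "group (BijGroup E)" by (rule group_BijGroup)
    fix \<sigma> assume s: "\<sigma> \<in> carrier (aut_subgroup G A)"
    then show "restrict \<sigma> E \<in> carrier (BijGroup E)" using bij by (simp add: BijGroup_def)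
    fix \<tau> assume t: "\<tau> \<in> carrier (aut_subgroup G A)"
    have "restrict (\<sigma> \<otimes>\<^bsub>AutoGroup G\<^esub> \<tau>) E = compose E (restrict \<sigma> E) (restrict \<tau> E)"
      using s t sub E inv[of \<tau>] by (auto simp: compose_def fun_eq_iff AutoGroup_mult_apply subset_iff)
    then show "restrict (\<sigma> \<otimes>\<^bsub>aut_subgroup G A\<^esub> \<tau>) E
        = restrict \<sigma> E \<otimes>\<^bsub>BijGroup E\<^esub> restrict \<tau> E"
      using s t bij by (simp add: BijGroup_def)
  qed
  then show ?thesis
    by (auto simp: aut_transitive_on_def transitive_action_def transitive_action_axioms_def)
qed

text \<open>Because \<open>N\<close> fixes each member of \<open>S\<close> as a set, all elements of
  one coset of \<open>N\<close> move that member in the same way; hence the quotient acts.\<close>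

lemma aut_factor_transitive_onI:
  assumes A: "subgroup A (AutoGroup G)" and N: "N \<lhd> aut_subgroup G A"
    and S: "\<And>E. E \<in> S \<Longrightarrow> E \<subseteq> carrier G"
    and AS: "\<And>\<sigma> E. \<sigma> \<in> A \<Longrightarrow> E \<in> S \<Longrightarrow> \<sigma> ` E \<in> S"
    and NS: "\<And>\<nu> E. \<nu> \<in> N \<Longrightarrow> E \<in> S \<Longrightarrow> \<nu> ` E = E"
    and trans: "\<And>E F. E \<in> S \<Longrightarrow> F \<in> S \<Longrightarrow> \<exists>\<sigma>\<in>A. \<sigma> ` E = F"
  shows "aut_factor_transitive_on G A N S"
proof -
  let ?A = "aut_subgroup G A"
  interpret N: normal N ?A by (rule N)
  have sub: "A \<subseteq> auto G" using subgroup.subset[OF A] by simp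
  have Nsub: "N \<subseteq> A" using N.subset by simp
  \<comment> \<open>Taking the union over the whole coset avoids choosing a representative; the sets
    united will all turn out to be equal.\<close>
  define \<psi> :: "('a \<Rightarrow> 'a) set \<Rightarrow> 'a set \<Rightarrow> 'a set" where "\<psi> = (\<lambda>X. \<lambda>E\<in>S. \<Union>\<sigma>\<in>X. \<sigma> ` E)"
  have psi: "\<psi> (N #>\<^bsub>?A\<^esub> \<sigma>) E = \<sigma> ` E" if s: "\<sigma> \<in> A" and E: "E \<in> S" for \<sigma> E
  proof -
    have img: "(\<nu> \<otimes>\<^bsub>AutoGroup G\<^esub> \<sigma>) ` E = \<sigma> ` E" if "\<nu> \<in> N" for \<nu>
      using that s E sub Nsub S AS NS by (subst AutoGroup_mult_image) auto
    have "(\<Union>\<nu>\<in>N. (\<nu> \<otimes>\<^bsub>AutoGroup G\<^esub> \<sigma>) ` E) = (\<Union>\<nu>\<in>N. \<sigma> ` E)"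
      using img by (intro SUP_cong refl)
    also have "\<dots> = \<sigma> ` E"
      using subgroup.one_closed[OF normal_imp_subgroup[OF N]] by blast
    finally show ?thesis using E unfolding \<psi>_def r_coset_def by simp
  qed
  have psi_r: "\<psi> (N #>\<^bsub>?A\<^esub> \<sigma>) = (\<lambda>E\<in>S. \<sigma> ` E)" if "\<sigma> \<in> A" for \<sigma>
    using psi[OF that] by (auto simp: \<psi>_def restrict_def fun_eq_iff)
  have bij: "(\<lambda>E\<in>S. \<sigma> ` E) \<in> Bij S" if s: "\<sigma> \<in> A" for \<sigma>
  proof -
    have "inj_on ((`) \<sigma>) S"
    proof (rule inj_onI)
      fix E F assume "E \<in> S" "F \<in> S" "\<sigma> ` E = \<sigma> ` F"
      then show "E = F"
        using S s sub auto_bij[of \<sigma>] by (metis bij_betw_imp_inj_on inj_on_image_eq_iff subsetD)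
    qed
    moreover have "(`) \<sigma> ` S = S"
    proof
      show "(`) \<sigma> ` S \<subseteq> S" using AS s by blast
      show "S \<subseteq> (`) \<sigma> ` S"
      proof
        fix E assume E: "E \<in> S"
        \<comment> \<open>The preimage of \<open>E\<close> is its image under the inverse
          automorphism, so finiteness of \<open>S\<close> is not involved.\<close>
        have "inv\<^bsub>AutoGroup G\<^esub> \<sigma> \<in> A" using A s by (simp add: subgroup.m_inv_closed)
        then have "(inv\<^bsub>AutoGroup G\<^esub> \<sigma>) ` E \<in> S" using AS E by simp
        moreover have "\<sigma> ` (inv\<^bsub>AutoGroup G\<^esub> \<sigma>) ` E = E"
          using AutoGroup_inv_image S[OF E] s sub by blast
        ultimately show "E \<in> (`) \<sigma> ` S" by (metis imageI)
      qed
    qed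
    ultimately show ?thesis by (simp add: Bij_def bij_betw_def)
  qed
  have car: "\<exists>\<sigma>\<in>A. X = N #>\<^bsub>?A\<^esub> \<sigma>" if "X \<in> carrier (?A Mod N)" for X
    using that by (auto simp: FactGroup_def RCOSETS_def)
  have "transitive_action (?A Mod N) S \<psi>"
  proof (intro transitive_action.intro group_action.intro group_hom.intro group_hom_axioms.intro homI
      transitive_action_axioms.intro)
    show "group (?A Mod N)" by (rule N.factorgroup_is_group)
    show "group (BijGroup S)" by (rule group_BijGroup)
    fix X assume X: "X \<in> carrier (?A Mod N)"
    then obtain \<sigma> where s: "\<sigma> \<in> A" "X = N #>\<^bsub>?A\<^esub> \<sigma>" using car by blast
    show "\<psi> X \<in> carrier (BijGroup S)" using s psi_r bij by (simp add: BijGroup_def)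
    fix Y assume Y: "Y \<in> carrier (?A Mod N)"
    then obtain \<tau> where t: "\<tau> \<in> A" "Y = N #>\<^bsub>?A\<^esub> \<tau>" using car by blast
    have XY: "X \<otimes>\<^bsub>?A Mod N\<^esub> Y = N #>\<^bsub>?A\<^esub> (\<sigma> \<otimes>\<^bsub>AutoGroup G\<^esub> \<tau>)"
      using s t N.rcos_sum[of \<sigma> \<tau>] by (simp add: FactGroup_def)
    have st: "\<sigma> \<otimes>\<^bsub>AutoGroup G\<^esub> \<tau> \<in> A" using A s t by (simp add: subgroup.m_closed)
    have "(\<lambda>E\<in>S. (\<sigma> \<otimes>\<^bsub>AutoGroup G\<^esub> \<tau>) ` E) = compose S (\<lambda>E\<in>S. \<sigma> ` E) (\<lambda>E\<in>S. \<tau> ` E)"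
      using s t sub S AS by (auto simp: compose_def fun_eq_iff AutoGroup_mult_image subset_iff)
    then show "\<psi> (X \<otimes>\<^bsub>?A Mod N\<^esub> Y) = \<psi> X \<otimes>\<^bsub>BijGroup S\<^esub> \<psi> Y"
      unfolding XY psi_r[OF st] using s t psi_r bij by (simp add: BijGroup_def)
  next
    fix E F assume "E \<in> S" "F \<in> S"
    then obtain \<sigma> where "\<sigma> \<in> A" "\<sigma> ` E = F" using trans by blast
    then show "\<exists>X\<in>carrier (?A Mod N). \<psi> X E = F"
      using psi \<open>E \<in> S\<close> by (intro bexI[of _ "N #>\<^bsub>?A\<^esub> \<sigma>"]) (auto simp: FactGroup_def RCOSETS_def)
  qed
  with psi N show ?thesis unfolding aut_factor_transitive_on_def by blast
qed

end

section \<open>Automorphisms of dihedral groups\<close>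

locale dihedral_group_ge_3 = dihedral_group +
  assumes n_ge_3: "n \<ge> 3"
begin

section \<open>Arithmetic of rotations and reflections\<close>

lemma n_pos: "n > 0"
  using n_ge_3 by simp

lemma finite_carrier: "finite (carrier G)"
  using order_eq n_pos by (auto simp: order_def intro: card_ge_0_finite)

lemma pow_a_closed: "a [^] (i::nat) \<in> carrier G"
  using a_closed by simp

lemma refl_closed: "b \<otimes> a [^] (i::nat) \<in> carrier G"
  using a_closed b_closed by simp

lemma rot_rot_mult: "a [^] (i::nat) \<otimes> a [^] (j::nat) = a [^] (i + j)"
  using a_closed by (rule nat_pow_mult)

lemma refl_rot_mult: "b \<otimes> a [^] (i::nat) \<otimes> a [^] (j::nat) = b \<otimes> a [^] (i + j)"
  using a_closed b_closed by (simp add: m_assoc rot_rot_mult)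

text \<open>Moving a rotation past \<open>b\<close> inverts it; the factor \<open>n - 1\<close> is
  -1 modulo \<open>n\<close>.\<close>

lemma rot_refl_mult: "a [^] (i::nat) \<otimes> (b \<otimes> a [^] (j::nat)) = b \<otimes> a [^] ((n - 1) * i + j)"
  using dihedral_mult[OF a_closed b_closed n_pos a_pow_n b_pow_2 bab, of 0 i 1 j] a_closed b_closed
  by simp

lemma refl_refl_mult: "b \<otimes> a [^] (i::nat) \<otimes> (b \<otimes> a [^] (j::nat)) = a [^] ((n - 1) * i + j)"
  using dihedral_mult[OF a_closed b_closed n_pos a_pow_n b_pow_2 bab, of 1 i 1 j] a_closed b_closed
    b_pow_2
  by (simp add: numeral_2_eq_2)

text \<open>The relations only bound the order from above. That it is not smaller comes from the
  order of the group, through the uniqueness of the normal form.\<close>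

lemma ord_a: "ord a = n"
proof -
  have le: "ord a dvd n" using pow_eq_id[OF a_closed] a_pow_n by simp
  have "\<not> ord a < n"
  proof
    assume "ord a < n"
    moreover have "b [^] (0::nat) \<otimes> a [^] ord a = b [^] (0::nat) \<otimes> a [^] (0::nat)"
      using a_closed by simp
    ultimately have "ord a = 0"
      using inj_onD[OF bij_betw_imp_inj_on[OF normal_form[OF n_pos]], of "(0, ord a)" "(0, 0)"] n_pos
      by simp
    then show False using le n_pos by simp
  qed
  then show ?thesis using le n_pos by (simp add: dvd_imp_le le_antisym)
qed

lemma rot_eq_iff: "a [^] (i::nat) = a [^] (j::nat) \<longleftrightarrow> [i = j] (mod n)"
  using int_pow_eq[OF a_closed, of "int i" "int j"] ord_a
  by (simp add: int_pow_int cong_iff_dvd_diff dvd_diff_commute flip: cong_int_iff)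

lemma refl_eq_iff: "b \<otimes> a [^] (i::nat) = b \<otimes> a [^] (j::nat) \<longleftrightarrow> [i = j] (mod n)"
  using a_closed b_closed by (simp add: rot_eq_iff)

lemma refl_neq_rot: "b \<otimes> a [^] (i::nat) \<noteq> a [^] (j::nat)"
proof
  assume "b \<otimes> a [^] i = a [^] j"
  then have "b [^] (1::nat) \<otimes> a [^] (i mod n) = b [^] (0::nat) \<otimes> a [^] (j mod n)"
    using a_closed b_closed pow_mod_eq[OF a_closed a_pow_n] by simp
  then show False
    using inj_onD[OF bij_betw_imp_inj_on[OF normal_form[OF n_pos]], of "(1, i mod n)" "(0, j mod n)"] n_pos
    by simp
qed

lemma rot_or_refl:
  assumes "x \<in> carrier G"
  obtains (rot) i :: nat where "x = a [^] i" | (refl) i :: nat where "x = b \<otimes> a [^] i"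
proof -
  have "x \<in> (\<lambda>(s, i). b [^] s \<otimes> a [^] i) ` ({..<2::nat} \<times> {..<n})"
    using assms normal_form[OF n_pos] by (simp add: bij_betw_def)
  then obtain s i where "s < 2" "x = b [^] (s::nat) \<otimes> a [^] (i::nat)" by auto
  moreover from \<open>s < 2\<close> have "s = 0 \<or> s = 1" by auto
  ultimately show ?thesis using that a_closed b_closed by auto
qed

text \<open>The left side is j - i modulo \<open>n\<close>, written without subtraction; the proof
  passes to integers to say so.\<close>

lemma pred_mult_add_cong: "[(n - 1) * i + j = 0] (mod n) \<longleftrightarrow> [i = j] (mod n)"
proof -
  have "int ((n - 1) * i + j) = int j - int i + int n * int i"
    using n_pos by (cases n) (simp_all add: algebra_simps)
  then have "[int ((n - 1) * i + j) = 0] (mod int n) \<longleftrightarrow> [int i = int j] (mod int n)"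
    by (metis cong_0_iff cong_iff_dvd_diff cong_sym_eq dvd_add_left_iff dvd_triv_left)
  then show ?thesis by (metis cong_int_iff of_nat_0)
qed

lemma refl_inv: "inv (b \<otimes> a [^] (i::nat)) = b \<otimes> a [^] i"
proof -
  have "b \<otimes> a [^] i \<otimes> (b \<otimes> a [^] i) = a [^] (0::nat)"
    unfolding refl_refl_mult rot_eq_iff pred_mult_add_cong by simp
  then show ?thesis using refl_closed by (intro inv_equality) auto
qed

lemma refl_neq_one: "b \<otimes> a [^] (i::nat) \<noteq> \<one>"
  using refl_neq_rot[of i 0] by simp

lemma ord_refl: "ord (b \<otimes> a [^] (i::nat)) = 2"
proof -
  have "(b \<otimes> a [^] i) [^] (2::nat) = \<one>"
    using refl_inv[of i] refl_closed[of i] r_inv[of "b \<otimes> a [^] i"] by (simp add: numeral_2_eq_2)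
  then have "ord (b \<otimes> a [^] i) dvd 2" using pow_eq_id refl_closed by blast
  moreover have "ord (b \<otimes> a [^] i) \<noteq> 1"
    using refl_neq_one refl_closed pow_eq_id[OF refl_closed, of i 1] by auto
  ultimately show ?thesis by (metis dvd_0_left_iff numeral_neq_zero prime_nat_iff two_is_prime_nat)
qed

text \<open>A rotation of order 2 equals its own inverse and so commutes with \<open>b\<close> as
  well as with \<open>a\<close>, hence is central. A reflection commutes with \<open>a\<close> only
  if \<open>n\<close> divides 2.\<close>

lemma noncentral_involutions:
  "{x \<in> carrier G. ord x = 2 \<and> (\<exists>y\<in>carrier G. x \<otimes> y \<noteq> y \<otimes> x)} = {b \<otimes> a [^] i | i. i \<le> n - 1}"
proof (intro equalityI subsetI)
  fix x assume "x \<in> {x \<in> carrier G. ord x = 2 \<and> (\<exists>y\<in>carrier G. x \<otimes> y \<noteq> y \<otimes> x)}"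
  then have x: "x \<in> carrier G" "ord x = 2" and "\<exists>y\<in>carrier G. x \<otimes> y \<noteq> y \<otimes> x" by auto
  then obtain y where y: "y \<in> carrier G" "x \<otimes> y \<noteq> y \<otimes> x" by blast
  show "x \<in> {b \<otimes> a [^] i | i. i \<le> n - 1}"
    using x(1)
  proof (cases rule: rot_or_refl)
    case (refl i)
    then have "x = b \<otimes> a [^] (i mod n)" using pow_mod_eq[OF a_closed a_pow_n] by simp
    moreover have "i mod n \<le> n - 1" using mod_less_divisor[OF n_pos, of i] by linarith
    ultimately show ?thesis by blast
  next
    case (rot i)
    have ii: "[i + i = 0] (mod n)"
    proof -
      have "x [^] (2::nat) = \<one>" using x by (metis pow_ord_eq_1)
      then have "a [^] (i + i) = a [^] (0::nat)"
        using rot a_closed by (simp add: numeral_2_eq_2 rot_rot_mult)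
      then show ?thesis using rot_eq_iff by blast
    qed
    show ?thesis using y(1)
    proof (cases rule: rot_or_refl)
      case (rot j)
      then show ?thesis using y \<open>x = a [^] i\<close> by (simp add: rot_rot_mult add.commute)
    next
      case (refl j)
      have "[(n - 1) * i + j = j + i] (mod n)"
      proof -
        \<comment> \<open>Adding 2i, which vanishes modulo \<open>n\<close>, turns -i into
          i.\<close>
        have "(n - 1) * i + j + (i + i) = j + i + n * i"
          using n_pos by (cases n) simp_all
        then have "[(n - 1) * i + j + (i + i) = j + i] (mod n)"
          unfolding cong_def by (simp only: mod_mult_self2)
        moreover have "[(n - 1) * i + j + 0 = (n - 1) * i + j + (i + i)] (mod n)"
          by (rule cong_add[OF cong_refl cong_sym[OF ii]])
        ultimately show ?thesis unfolding cong_def by simp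
      qed
      then show ?thesis using y \<open>x = a [^] i\<close> refl
        by (simp add: refl_rot_mult rot_refl_mult refl_eq_iff)
    qed
  qed
next
  fix x assume "x \<in> {b \<otimes> a [^] i | i. i \<le> n - 1}"
  then obtain i where x: "x = b \<otimes> a [^] (i::nat)" by blast
  have "x \<otimes> a [^] (1::nat) \<noteq> a [^] (1::nat) \<otimes> x"
  proof
    assume "x \<otimes> a [^] (1::nat) = a [^] (1::nat) \<otimes> x"
    then have "[i + 1 = n - 1 + i] (mod n)"
      unfolding x refl_rot_mult rot_refl_mult refl_eq_iff by simp
    \<comment> \<open>One more unit on both sides absorbs the truncated
      \<open>n - 1\<close>.\<close>
    then have "[i + 1 + 1 = n - 1 + i + 1] (mod n)" by (rule cong_add[OF _ cong_refl])
    moreover have "n - 1 + i + 1 = 0 + i + n" using n_pos by simp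
    ultimately have "[2 + i = 0 + i] (mod n)" by (simp add: cong_def)
    then have "[2 = 0] (mod n)" by (simp only: cong_add_rcancel_nat)
    then show False using n_ge_3 by (simp add: cong_def)
  qed
  then show "x \<in> {x \<in> carrier G. ord x = 2 \<and> (\<exists>y\<in>carrier G. x \<otimes> y \<noteq> y \<otimes> x)}"
    using x ord_refl refl_closed pow_a_closed by blast
qed

section \<open>Automorphisms in terms of exponents\<close>

lemma auto_eqI:
  assumes "\<sigma> \<in> auto G" "\<tau> \<in> auto G" "\<sigma> a = \<tau> a" "\<sigma> b = \<tau> b"
  shows "\<sigma> = \<tau>"
proof -
  interpret s: group_hom G G \<sigma> using assms(1) by (rule auto_hom)
  interpret t: group_hom G G \<tau> using assms(2) by (rule auto_hom)
  show ?thesis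
  proof (rule extensionalityI[of _ "carrier G"])
    fix x assume "x \<in> carrier G"
    then show "\<sigma> x = \<tau> x"
      by (cases rule: rot_or_refl) (use assms a_closed b_closed in \<open>simp_all add: s.hom_nat_pow t.hom_nat_pow\<close>)
  qed (use assms in \<open>auto simp: auto_def Bij_def\<close>)
qed

text \<open>On exponents of reflections an automorphism is an affine map; these coordinates carry
  the later computations.\<close>

lemma auto_apply:
  assumes "\<sigma> \<in> auto G" "\<sigma> a = a [^] (k::nat)" "\<sigma> b = b \<otimes> a [^] (j::nat)"
  shows "\<sigma> (a [^] (i::nat)) = a [^] (k * i)" "\<sigma> (b \<otimes> a [^] (i::nat)) = b \<otimes> a [^] (j + k * i)"
proof -
  interpret s: group_hom G G \<sigma> using assms(1) by (rule auto_hom)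
  show 1: "\<sigma> (a [^] i) = a [^] (k * i)"
    using assms a_closed by (simp add: s.hom_nat_pow nat_pow_pow)
  show "\<sigma> (b \<otimes> a [^] i) = b \<otimes> a [^] (j + k * i)"
    using assms a_closed b_closed 1 by (simp add: refl_rot_mult)
qed

text \<open>Automorphisms preserve element orders, so \<open>a\<close>, of order at least 3, stays a
  rotation, and its image has order \<open>n\<close> only if \<open>k\<close> is a unit modulo
  \<open>n\<close>. Orders alone do not settle the image of \<open>b\<close>, since a rotation may
  also have order 2.\<close>

lemma auto_exponents:
  assumes "\<sigma> \<in> auto G"
  obtains k j where "coprime k n" "0 < k" "k < n" "j < n" "\<sigma> a = a [^] (k::nat)" "\<sigma> b = b \<otimes> a [^] (j::nat)"
proof -
  interpret s: group_hom G G \<sigma> using assms by (rule auto_hom)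
  have inj: "inj_on \<sigma> (carrier G)" using auto_bij[OF assms] by (simp add: bij_betw_def)
  have ords: "ord (\<sigma> x) = ord x" if "x \<in> carrier G" for x
  proof -
    have "(\<sigma> x) [^] m = \<one> \<longleftrightarrow> x [^] m = \<one>" for m :: nat
      using that inj by (metis inj_onD nat_pow_closed one_closed s.hom_nat_pow s.hom_one)
    then show ?thesis
      using that by (metis auto_closed[OF assms] dvd_antisym dvd_refl pow_eq_id)
  qed
  have "\<exists>k. \<sigma> a = a [^] (k::nat)"
    using auto_closed[OF assms a_closed]
  proof (cases rule: rot_or_refl)
    case (refl i)
    then show ?thesis using ords[OF a_closed] ord_refl ord_a n_ge_3 by simp
  qed blast
  then obtain k0 where k0: "\<sigma> a = a [^] (k0::nat)" by blast
  define k where "k = k0 mod n"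
  have k: "\<sigma> a = a [^] k" "k < n" using k0 pow_mod_eq[OF a_closed a_pow_n] n_pos by (simp_all add: k_def)
  have cop: "coprime k n"
    using ords[OF a_closed] k pow_ord_eq_ord_iff[OF finite_carrier a_closed, of k] ord_a by simp
  then have "k \<noteq> 0" using n_ge_3 by (cases "k = 0") auto
  have "\<exists>j. \<sigma> b = b \<otimes> a [^] (j::nat)"
    using auto_closed[OF assms b_closed]
  proof (cases rule: rot_or_refl)
    \<comment> \<open>A rotation as image of \<open>b\<close> would commute with the image of
      \<open>a\<close>. By injectivity \<open>a\<close> and \<open>b\<close> would commute, which
      means that -1 and 1 agree modulo \<open>n\<close>.\<close>
    case (rot i)
    then have "\<sigma> (a \<otimes> b) = \<sigma> (b \<otimes> a)"
      using k(1) nat_pow_comm[OF a_closed, of k i] by (simp only: s.hom_mult a_closed b_closed)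
    then have "a \<otimes> b = b \<otimes> a" using inj a_closed b_closed by (metis inj_onD m_closed)
    then have "a [^] (1::nat) \<otimes> (b \<otimes> a [^] (0::nat)) = b \<otimes> a [^] (1::nat)"
      using a_closed b_closed by simp
    then have "[n - 1 = 1] (mod n)" unfolding rot_refl_mult refl_eq_iff by simp
    then show ?thesis using n_ge_3 by (simp add: cong_def)
  qed blast
  then obtain j0 where j0: "\<sigma> b = b \<otimes> a [^] (j0::nat)" by blast
  then have "\<sigma> b = b \<otimes> a [^] (j0 mod n)" using pow_mod_eq[OF a_closed a_pow_n] by simp
  then show ?thesis using that[of k "j0 mod n"] cop k \<open>k \<noteq> 0\<close> n_pos by simp
qed

lemma auto_refl:
  assumes "\<sigma> \<in> auto G"
  obtains j where "\<sigma> (b \<otimes> a [^] (i::nat)) = b \<otimes> a [^] (j::nat)"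
  using auto_exponents[OF assms] auto_apply(2)[OF assms] by metis

lemma auto_obtain:
  assumes "coprime k n"
  obtains \<sigma> where "\<sigma> \<in> auto G" "\<sigma> a = a [^] (k::nat)" "\<sigma> b = b \<otimes> a [^] (j::nat)"
  using dihedral_auto_ex1[OF n_pos assms, of j] by blast

section \<open>The automorphisms \<phi> and \<tau>\<close>

lemma phi_props:
  "dihedral_phi G a b \<in> auto G" "dihedral_phi G a b a = a" "dihedral_phi G a b b = b \<otimes> a"
  using theI'[OF dihedral_auto_ex1[OF n_pos, of 1 1]] a_closed by (simp_all add: dihedral_phi_def)

lemma tau_props:
  assumes "coprime k n"
  shows "dihedral_tau G a b k \<in> auto G" "dihedral_tau G a b k a = a [^] k" "dihedral_tau G a b k b = b"
  using theI'[OF dihedral_auto_ex1[OF n_pos assms, of 0]] b_closed by (simp_all add: dihedral_tau_def)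

lemma phi_pow_props:
  defines "\<phi> \<equiv> dihedral_phi G a b"
  shows "\<phi> [^]\<^bsub>AutoGroup G\<^esub> (m::nat) \<in> auto G" "(\<phi> [^]\<^bsub>AutoGroup G\<^esub> m) a = a"
    "(\<phi> [^]\<^bsub>AutoGroup G\<^esub> m) b = b \<otimes> a [^] m"
proof (induction m)
  case 0
  show "\<phi> [^]\<^bsub>AutoGroup G\<^esub> (0::nat) \<in> auto G" "(\<phi> [^]\<^bsub>AutoGroup G\<^esub> (0::nat)) a = a"
    "(\<phi> [^]\<^bsub>AutoGroup G\<^esub> (0::nat)) b = b \<otimes> a [^] (0::nat)"
    using a_closed b_closed id_in_auto by (simp_all add: AutoGroup_one)
next
  case (Suc m)
  note p = phi_props[folded \<phi>_def]
  show "\<phi> [^]\<^bsub>AutoGroup G\<^esub> Suc m \<in> auto G" using Suc p AutoGroup_mult_closed by simp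
  show "(\<phi> [^]\<^bsub>AutoGroup G\<^esub> Suc m) a = a"
    using Suc p a_closed by (simp add: AutoGroup_mult_apply)
  have "(\<phi> [^]\<^bsub>AutoGroup G\<^esub> m) (b \<otimes> a [^] (1::nat)) = b \<otimes> a [^] (m + 1 * 1)"
    using Suc a_closed by (intro auto_apply) simp_all
  then show "(\<phi> [^]\<^bsub>AutoGroup G\<^esub> Suc m) b = b \<otimes> a [^] Suc m"
    using p Suc a_closed b_closed by (simp add: AutoGroup_mult_apply)
qed

text \<open>Finiteness allows a cyclic subgroup to be listed by natural powers of its generator,
  without inverses.\<close>

lemma finite_AutoGroup: "finite (carrier (AutoGroup G))"
proof (rule finite_subset)
  show "carrier (AutoGroup G) \<subseteq> carrier G \<rightarrow>\<^sub>E carrier G"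
    by (auto simp: auto_def Bij_def bij_betw_def PiE_def)
qed (use finite_carrier in \<open>intro finite_PiE\<close>)

text \<open>An automorphism is determined by its values on \<open>a\<close> and \<open>b\<close>, so
  membership in this cyclic group becomes a condition on one exponent.\<close>

lemma generate_phi_pow:
  "generate (AutoGroup G) {dihedral_phi G a b [^]\<^bsub>AutoGroup G\<^esub> r}
     = {\<sigma> \<in> auto G. \<sigma> a = a \<and> (\<exists>m. \<sigma> b = b \<otimes> a [^] (r * m :: nat))}"
proof -
  interpret A: group "AutoGroup G" by (rule AutoGroup)
  let ?\<phi> = "dihedral_phi G a b"
  have gen: "generate (AutoGroup G) {?\<phi> [^]\<^bsub>AutoGroup G\<^esub> r}
      = {?\<phi> [^]\<^bsub>AutoGroup G\<^esub> (r * m) | m. m \<in> UNIV}"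
    using A.generate_pow_on_finite_carrier[OF finite_AutoGroup] phi_pow_props(1) phi_props(1)
    by (simp add: A.nat_pow_pow)
  have eq: "\<sigma> = ?\<phi> [^]\<^bsub>AutoGroup G\<^esub> (r * m)"
    if "\<sigma> \<in> auto G" "\<sigma> a = a" "\<sigma> b = b \<otimes> a [^] (r * m)" for \<sigma> m
    using that phi_pow_props by (intro auto_eqI) auto
  show ?thesis
    unfolding gen
  proof (intro equalityI subsetI)
    fix \<sigma> assume "\<sigma> \<in> {?\<phi> [^]\<^bsub>AutoGroup G\<^esub> (r * m) | m. m \<in> UNIV}"
    then obtain m where "\<sigma> = ?\<phi> [^]\<^bsub>AutoGroup G\<^esub> (r * m)" by blast
    then show "\<sigma> \<in> {\<sigma> \<in> auto G. \<sigma> a = a \<and> (\<exists>m. \<sigma> b = b \<otimes> a [^] (r * m :: nat))}"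
      using phi_pow_props by blast
  next
    fix \<sigma> assume "\<sigma> \<in> {\<sigma> \<in> auto G. \<sigma> a = a \<and> (\<exists>m. \<sigma> b = b \<otimes> a [^] (r * m :: nat))}"
    then show "\<sigma> \<in> {?\<phi> [^]\<^bsub>AutoGroup G\<^esub> (r * m) | m. m \<in> UNIV}"
      using eq by blast
  qed
qed

text \<open>This is the case \<open>r = 1\<close> above, where the condition on the image of
  \<open>b\<close> holds for every automorphism.\<close>

lemma generate_phi: "generate (AutoGroup G) {dihedral_phi G a b} = {\<sigma> \<in> auto G. \<sigma> a = a}"
proof -
  interpret A: group "AutoGroup G" by (rule AutoGroup)
  have ex: "\<exists>m. \<sigma> b = b \<otimes> a [^] (m::nat)" if "\<sigma> \<in> auto G" for \<sigma>
    using auto_exponents[OF that] by metis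
  have one: "dihedral_phi G a b [^]\<^bsub>AutoGroup G\<^esub> (1::nat) = dihedral_phi G a b"
    using phi_props(1) by simp
  show ?thesis
    using generate_phi_pow[of 1] unfolding one mult_1
    by (rule trans) (intro Collect_cong, use ex in blast)
qed

end

section \<open>Sets of reflections\<close>

context dihedral_group_ge_3
begin

section \<open>Reflection cosets as residue classes\<close>

lemma reflection_coset_eq:
  assumes r: "r > 0" "r dvd n"
  shows "reflection_coset G a b r i = {b \<otimes> a [^] j | j. [j = i] (mod r)}"
proof (intro equalityI subsetI)
  have gen: "generate G {a [^] r} = {a [^] (r * m) | m. m \<in> (UNIV :: nat set)}"
    using generate_pow_on_finite_carrier[OF finite_carrier, of "a [^] r"] a_closed
    by (simp add: nat_pow_pow)
  {
    fix x assume "x \<in> reflection_coset G a b r i"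
    then obtain m :: nat where "x = b \<otimes> a [^] i \<otimes> a [^] (r * m)"
      unfolding reflection_coset_def gen l_coset_def by blast
    then have "x = b \<otimes> a [^] (i + r * m)" by (simp only: refl_rot_mult)
    moreover have "[i + r * m = i] (mod r)" by (simp add: cong_def)
    ultimately show "x \<in> {b \<otimes> a [^] j | j. [j = i] (mod r)}" by blast
  next
    fix x assume "x \<in> {b \<otimes> a [^] j | j. [j = i] (mod r)}"
    then obtain j where x: "x = b \<otimes> a [^] j" and j: "[j = i] (mod r)" by blast
    \<comment> \<open>Adding \<open>n * i\<close> to the exponent does not change the reflection but
      makes it at least \<open>i\<close>, so that the difference from \<open>i\<close> is a natural
      multiple of \<open>r\<close>.\<close>
    have "[n * i = 0] (mod r)" using r(2) by (simp add: cong_0_iff)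
    then have "[j + n * i = i] (mod r)" using cong_add[OF j] by fastforce
    moreover have "i \<le> j + n * i" using n_pos by (cases n) simp_all
    ultimately obtain m where m: "j + n * i = i + r * m"
      by (auto simp: cong_le_nat add.commute mult.commute)
    have "x = b \<otimes> a [^] (i + r * m)"
      unfolding x refl_eq_iff m[symmetric] by (simp add: cong_def)
    then have "x = b \<otimes> a [^] i \<otimes> a [^] (r * m)" by (simp only: refl_rot_mult)
    then show "x \<in> reflection_coset G a b r i"
      unfolding reflection_coset_def gen l_coset_def by blast
  }
qed

text \<open>The exponent of a reflection is defined only modulo \<open>n\<close>; since
  \<open>r\<close> divides \<open>n\<close>, its residue modulo \<open>r\<close> is still well
  defined.\<close>

lemma refl_mem_coset_iff:
  assumes r: "r > 0" "r dvd n"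
  shows "b \<otimes> a [^] (j::nat) \<in> reflection_coset G a b r i \<longleftrightarrow> [j = i] (mod r)"
proof
  assume "b \<otimes> a [^] j \<in> reflection_coset G a b r i"
  then obtain l where "b \<otimes> a [^] j = b \<otimes> a [^] l" "[l = i] (mod r)"
    unfolding reflection_coset_eq[OF r] by blast
  then show "[j = i] (mod r)"
    unfolding refl_eq_iff using r(2) by (metis cong_dvd_modulus_nat cong_trans)
qed (auto simp: reflection_coset_eq[OF r])

lemma reflection_coset_cong:
  assumes r: "r > 0" "r dvd n" and "[i = j] (mod r)"
  shows "reflection_coset G a b r i = reflection_coset G a b r j"
  using assms(3) unfolding reflection_coset_eq[OF r] cong_def by simp

lemma reflection_coset_subset:
  assumes r: "r > 0" "r dvd n"
  shows "reflection_coset G a b r i \<subseteq> carrier G"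
  unfolding reflection_coset_eq[OF r] using refl_closed by blast

text \<open>The multiplier \<open>k\<close> is coprime to \<open>n\<close>, hence to
  \<open>r\<close>, so the affine map on exponents both preserves and reflects congruence modulo
  \<open>r\<close>.\<close>

lemma auto_reflection_coset:
  assumes r: "r > 0" "r dvd n" and s: "\<sigma> \<in> auto G"
    and ij: "\<sigma> (b \<otimes> a [^] i) = b \<otimes> a [^] (j::nat)"
  shows "\<sigma> ` reflection_coset G a b r i = reflection_coset G a b r j"
proof -
  obtain k l where kl: "coprime k n" "\<sigma> a = a [^] (k::nat)" "\<sigma> b = b \<otimes> a [^] (l::nat)"
    using auto_exponents[OF s] by metis
  note ap = auto_apply[OF s kl(2,3)]
  have j: "[j = l + k * i] (mod r)"
    using ij[unfolded ap refl_eq_iff] r(2) by (metis cong_dvd_modulus_nat cong_sym)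
  have cop: "coprime k r" using kl(1) r(2) by (metis coprime_divisors dvd_refl)
  have iff: "\<sigma> (b \<otimes> a [^] p) \<in> reflection_coset G a b r j
      \<longleftrightarrow> b \<otimes> a [^] p \<in> reflection_coset G a b r i" for p :: nat
  proof -
    have "[l + k * p = j] (mod r) \<longleftrightarrow> [l + k * p = l + k * i] (mod r)"
      using j by (simp add: cong_def)
    also have "\<dots> \<longleftrightarrow> [p = i] (mod r)"
      using cop by (simp add: cong_add_lcancel_nat cong_mult_lcancel_nat)
    finally show ?thesis by (simp add: ap refl_mem_coset_iff[OF r])
  qed
  show ?thesis
  proof (intro equalityI subsetI)
    fix y assume "y \<in> \<sigma> ` reflection_coset G a b r i"
    then obtain x where x: "x \<in> reflection_coset G a b r i" "y = \<sigma> x" by blast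
    then obtain p where "x = b \<otimes> a [^] (p::nat)" unfolding reflection_coset_eq[OF r] by blast
    then show "y \<in> reflection_coset G a b r j" using x iff by simp
  next
    fix y assume y: "y \<in> reflection_coset G a b r j"
    then have "y \<in> \<sigma> ` carrier G"
      using reflection_coset_subset[OF r] bij_betw_imp_surj_on[OF auto_bij[OF s]] by auto
    then obtain x where x: "x \<in> carrier G" "y = \<sigma> x" by blast
    from x(1) show "y \<in> \<sigma> ` reflection_coset G a b r i"
    proof (cases rule: rot_or_refl)
      \<comment> \<open>A rotation cannot be the preimage, because its image is again a
        rotation.\<close>
      case (rot p)
      then have "y = a [^] (k * p)" using x ap by simp
      moreover obtain q where "y = b \<otimes> a [^] (q::nat)" using y unfolding reflection_coset_eq[OF r] by blast
      ultimately show ?thesis using refl_neq_rot by simp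
    next
      case (refl p)
      then show ?thesis using y x iff by blast
    qed
  qed
qed

section \<open>Generation and transitivity\<close>

lemma generating_reflections_dvd:
  assumes d: "d dvd n" and C: "C \<subseteq> {b \<otimes> a [^] j | j. d dvd j}" and gen: "generate G C = carrier G"
  shows "d = 1"
proof -
  \<comment> \<open>This is the subgroup generated by \<open>a [^] d\<close> and \<open>b\<close>;
    it contains \<open>C\<close>, and it contains \<open>a\<close> only if
    \<open>d = 1\<close>.\<close>
  define K where "K = {a [^] j | j. d dvd j} \<union> {b \<otimes> a [^] j | j. d dvd j}"
  have "x \<in> K" if "x \<in> generate G C" for x
    using that
  proof (induction rule: generate.induct)
    case one
    have "\<one> = a [^] (0::nat)" by simp
    then show ?case unfolding K_def by blast
  next
    case (incl h)
    then show ?case using C unfolding K_def by blast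
  next
    case (inv h)
    then obtain j where "h = b \<otimes> a [^] j" "d dvd j" using C by blast
    then show ?case using refl_inv unfolding K_def by auto
  next
    case (eng g h)
    obtain i where i: "d dvd i" "g = a [^] i \<or> g = b \<otimes> a [^] i"
      using eng.IH(1) unfolding K_def by blast
    obtain j where j: "d dvd j" "h = a [^] j \<or> h = b \<otimes> a [^] j"
      using eng.IH(2) unfolding K_def by blast
    have "d dvd i + j" "d dvd (n - 1) * i + j" using i j by simp_all
    moreover have "g \<otimes> h \<in> {a [^] (i + j), b \<otimes> a [^] ((n - 1) * i + j),
        b \<otimes> a [^] (i + j), a [^] ((n - 1) * i + j)}"
      using i j rot_rot_mult rot_refl_mult refl_rot_mult refl_refl_mult by blast
    ultimately show ?case unfolding K_def by blast
  qed
  then have "a [^] (1::nat) \<in> K" using gen a_closed by simp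
  then obtain j where j: "d dvd j" "a [^] (1::nat) = a [^] j"
    unfolding K_def using refl_neq_rot[symmetric] by blast
  then have "[1 = j] (mod d)" unfolding rot_eq_iff using d by (metis cong_dvd_modulus_nat)
  then have "d dvd 1 \<longleftrightarrow> d dvd j" by (rule cong_dvd_iff)
  then show ?thesis using j(1) by simp
qed

text \<open>Without a reflection everything stays inside the rotation subgroup, which misses
  \<open>b\<close>.\<close>

lemma generating_set_has_reflection:
  assumes C: "C \<subseteq> carrier G" and gen: "generate G C = carrier G"
  obtains i :: nat where "b \<otimes> a [^] i \<in> C"
proof -
  have "\<exists>i::nat. b \<otimes> a [^] i \<in> C"
  proof (rule ccontr)
    assume no: "\<not> (\<exists>i::nat. b \<otimes> a [^] i \<in> C)"
    have "C \<subseteq> generate G {a}"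
    proof
      fix x assume x: "x \<in> C"
      then have "x \<in> carrier G" using C by blast
      then show "x \<in> generate G {a}"
      proof (cases rule: rot_or_refl)
        case (rot i)
        then show ?thesis
          unfolding generate_pow_on_finite_carrier[OF finite_carrier a_closed] by blast
      qed (use no x in blast)
    qed
    then have "generate G C \<subseteq> generate G {a}"
      using generate_is_subgroup[of "{a}"] a_closed generate_subgroup_incl by simp
    then have "b \<in> generate G {a}" using gen b_closed by blast
    then obtain j :: nat where "b = a [^] j"
      unfolding generate_pow_on_finite_carrier[OF finite_carrier a_closed] by blast
    then show False using refl_neq_rot[of 0 j] b_closed by simp
  qed
  then show ?thesis using that by blast
qed

text \<open>A reflection equals its inverse, so it lies in both or in neither of two mutually inverse
  orbits; this rules out the two-orbit case.\<close>

lemma transitive_gensets_iff: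
  "C \<in> transitive_gensets G \<longleftrightarrow>
     inverse_closed_generating_set G C \<and> (\<forall>x\<in>C. \<forall>y\<in>C. \<exists>\<sigma>\<in>Aut_on G C. \<sigma> x = y)"
proof (cases "inverse_closed_generating_set G C")
  case True
  then have C: "C \<subseteq> carrier G" "generate G C = carrier G"
    by (auto simp: inverse_closed_generating_set_def)
  let ?A = "aut_subgroup G (Aut_on G C)"
  have A: "subgroup (Aut_on G C) (AutoGroup G)" using C(1) by (rule subgroup_Aut_on)
  have trans: "aut_transitive_on G (Aut_on G C) C \<longleftrightarrow> (\<forall>x\<in>C. \<forall>y\<in>C. \<exists>\<sigma>\<in>Aut_on G C. \<sigma> x = y)"
    using A C(1) by (rule aut_transitive_on_iff) (simp add: Aut_on_def)
  have two_orbits: False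
    if O: "O1 \<noteq> O2" "orbits ?A C (\<lambda>\<sigma>. \<sigma>) = {O1, O2}" "O2 = (\<lambda>c. inv c) ` O1" for O1 O2
  proof -
    obtain i where c: "b \<otimes> a [^] (i::nat) \<in> C" using generating_set_has_reflection[OF C] by blast
    let ?O = "orbit ?A (\<lambda>\<sigma>. \<sigma>) (b \<otimes> a [^] i)"
    \<comment> \<open>The orbit of a reflection consists of reflections, so inversion fixes it
      pointwise.\<close>
    have "inv x = x" if x: "x \<in> ?O" for x
    proof -
      obtain \<sigma> where "\<sigma> \<in> auto G" "x = \<sigma> (b \<otimes> a [^] i)"
        using x by (auto simp: orbit_def Aut_on_def)
      then show ?thesis using auto_refl refl_inv by metis
    qed
    then have "(\<lambda>c. inv c) ` ?O = (\<lambda>c. c) ` ?O" by (intro image_cong refl)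
    then have inv_O: "(\<lambda>c. inv c) ` ?O = ?O" by simp
    have sub: "O1 \<subseteq> carrier G"
    proof -
      obtain x where "x \<in> C" "O1 = orbit ?A (\<lambda>\<sigma>. \<sigma>) x"
        using O(2) unfolding orbits_def by blast
      then show ?thesis using C(1) auto_closed by (auto simp: orbit_def Aut_on_def)
    qed
    \<comment> \<open>Inversion exchanges \<open>O1\<close> and \<open>O2\<close> in both
      directions. Whichever of them is the orbit fixed by inversion, the two coincide.\<close>
    have "(\<lambda>c. inv (inv c)) ` O1 = (\<lambda>c. c) ` O1" using sub by (intro image_cong) auto
    then have "O1 = (\<lambda>c. inv c) ` O2" unfolding O(3) image_image by simp
    moreover have "?O \<in> {O1, O2}"
      using c unfolding O(2)[symmetric] orbits_def by blast
    ultimately show False using O(1,3) inv_O by auto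
  qed
  have "\<not> (\<exists>O1 O2. O1 \<noteq> O2 \<and> orbits ?A C (\<lambda>\<sigma>. \<sigma>) = {O1, O2} \<and> O2 = (\<lambda>c. inv c) ` O1)"
    by (intro notI, elim exE conjE, rule two_orbits)
  then show ?thesis
    using True by (simp only: transitive_gensets_def mem_Collect_eq trans simp_thms)
next
  case False
  then show ?thesis by (simp only: transitive_gensets_def mem_Collect_eq simp_thms)
qed

lemma transitive_gensets_generating:
  assumes "C \<in> transitive_gensets G"
  shows "C \<noteq> {}" "C \<subseteq> carrier G" "generate G C = carrier G" "\<And>c. c \<in> C \<Longrightarrow> inv c \<in> C"
proof -
  have "inverse_closed_generating_set G C" using assms by (simp add: transitive_gensets_iff)
  then show "C \<noteq> {}" "C \<subseteq> carrier G" "generate G C = carrier G" "\<And>c. c \<in> C \<Longrightarrow> inv c \<in> C"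
    unfolding inverse_closed_generating_set_def by blast+
qed

lemma transitive_gensets_trans:
  assumes C: "C \<in> transitive_gensets G" and "x \<in> C" "y \<in> C"
  obtains \<sigma> where "\<sigma> \<in> Aut_on G C" "\<sigma> x = y"
proof -
  have "\<forall>x\<in>C. \<forall>y\<in>C. \<exists>\<sigma>\<in>Aut_on G C. \<sigma> x = y"
    using C unfolding transitive_gensets_iff by (rule conjunct2)
  then have "\<exists>\<sigma>\<in>Aut_on G C. \<sigma> x = y" using assms(2,3) by (elim ballE) auto
  then show thesis using that by (elim bexE)
qed

lemma transitive_gensets_refl:
  assumes C: "C \<in> transitive_gensets G"
  shows "C \<subseteq> range (\<lambda>i::nat. b \<otimes> a [^] i)"
proof
  fix x assume x: "x \<in> C"
  obtain i where i: "b \<otimes> a [^] (i::nat) \<in> C"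
    using generating_set_has_reflection[OF transitive_gensets_generating(2,3)[OF C]] by blast
  obtain \<sigma> where s: "\<sigma> \<in> Aut_on G C" "\<sigma> (b \<otimes> a [^] i) = x"
    by (rule transitive_gensets_trans[OF C i x])
  then have "\<sigma> \<in> auto G" by (simp add: Aut_on_def)
  then show "x \<in> range (\<lambda>i::nat. b \<otimes> a [^] i)" using auto_refl s(2) by (metis rangeI)
qed

lemma auto_image_transitive_gensets:
  assumes C: "C \<in> transitive_gensets G" and s: "\<sigma> \<in> auto G"
  shows "\<sigma> ` C \<in> transitive_gensets G"
proof -
  interpret s: group_hom G G \<sigma> using s by (rule auto_hom)
  note icg = transitive_gensets_generating[OF C]
  have "inverse_closed_generating_set G (\<sigma> ` C)"
    unfolding inverse_closed_generating_set_def
  proof (intro conjI ballI)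
    show "\<sigma> ` C \<subseteq> carrier G - {\<one>}"
    proof
      fix y assume "y \<in> \<sigma> ` C"
      then obtain c where c: "c \<in> C" "y = \<sigma> c" by blast
      \<comment> \<open>That the image avoids the identity is read off from its elements being
        reflections.\<close>
      then obtain i where "c = b \<otimes> a [^] (i::nat)" using transitive_gensets_refl[OF C] by blast
      then obtain j where y: "y = b \<otimes> a [^] (j::nat)" using auto_refl[OF s] c by metis
      then show "y \<in> carrier G - {\<one>}" using refl_closed refl_neq_one by simp
    qed
    have "generate G (\<sigma> ` C) = \<sigma> ` carrier G"
      using s.generate_img[OF icg(2)] icg(3) by simp
    then show "generate G (\<sigma> ` C) = carrier G" using auto_bij[OF s] by (simp add: bij_betw_def)
    fix y assume "y \<in> \<sigma> ` C"
    then obtain c where c: "c \<in> C" "y = \<sigma> c" by blast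
    then have "inv y = \<sigma> (inv c)" using icg(2) by auto
    then show "inv y \<in> \<sigma> ` C" using icg(4) c by blast
  qed (use icg in simp)
  moreover have "\<exists>\<beta>\<in>Aut_on G (\<sigma> ` C). \<beta> x = y" if "x \<in> \<sigma> ` C" "y \<in> \<sigma> ` C" for x y
  proof -
    from that obtain c d where cd: "c \<in> C" "d \<in> C" "x = \<sigma> c" "y = \<sigma> d" by blast
    obtain \<alpha> where al: "\<alpha> \<in> Aut_on G C" "\<alpha> c = d"
      by (rule transitive_gensets_trans[OF C cd(1,2)])
    let ?s = "inv\<^bsub>AutoGroup G\<^esub> \<sigma>"
    \<comment> \<open>The automorphism taking \<open>c\<close> to \<open>d\<close> is transported to
      the image set by conjugation.\<close>
    let ?\<beta> = "\<sigma> \<otimes>\<^bsub>AutoGroup G\<^esub> (\<alpha> \<otimes>\<^bsub>AutoGroup G\<^esub> ?s)"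
    have aa: "\<alpha> \<in> auto G" using al by (simp add: Aut_on_def)
    have s': "?s \<in> auto G" using s by (rule AutoGroup_inv_closed)
    have "?\<beta> \<in> aut_conj G (Aut_on G C) \<sigma>"
      using al(1) unfolding aut_conj_def aut_then_def by blast
    then have "?\<beta> \<in> Aut_on G (\<sigma> ` C)" by (simp add: aut_conj_Aut_on[OF s icg(2)])
    moreover have "?\<beta> x = y"
      using cd al(2) icg(2) s s' aa auto_closed[OF s]
      by (simp add: AutoGroup_mult_apply AutoGroup_mult_closed AutoGroup_inv_apply subset_iff)
    ultimately show ?thesis by blast
  qed
  ultimately show ?thesis by (simp add: transitive_gensets_iff)
qed

end

section \<open>Subgroups of order two\<close>

lemma (in group) generate_involution:
  assumes x: "x \<in> carrier G" and xx: "x \<otimes> x = \<one>"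
  shows "generate G {x} = {\<one>, x}"
proof
  have inv: "inv x = x" using x xx by (intro inv_equality)
  have "subgroup {\<one>, x} G" using x xx inv by unfold_locales auto
  then show "generate G {x} \<subseteq> {\<one>, x}" by (intro generate_subgroup_incl) auto
  show "{\<one>, x} \<subseteq> generate G {x}" by (auto intro: generate.one generate.incl)
qed

lemma (in group) involution_subgroup_iso:
  assumes x: "x \<in> carrier G" and xx: "x \<otimes> x = \<one>" and x1: "x \<noteq> \<one>"
  shows "G\<lparr>carrier := {\<one>, x}\<rparr> \<cong> integer_mod_group 2"
proof -
  let ?h = "\<lambda>y. if y = x then 1 else 0 :: int"
  have car: "carrier (integer_mod_group 2) = {0, 1}"
    by (auto simp: carrier_integer_mod_group)
  have "?h \<in> iso (G\<lparr>carrier := {\<one>, x}\<rparr>) (integer_mod_group 2)"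
    using x xx x1 by (auto simp: iso_def hom_def bij_betw_def inj_on_def car)
  then show ?thesis unfolding is_iso_def by blast
qed

context dihedral_group_ge_3
begin

section \<open>Decomposition into blocks, claim (a)\<close>

text \<open>The powers of \<phi>^r add multiples of \<open>r\<close> to the exponents of reflections
  and are therefore transitive on each block.\<close>

lemma shift_reflection:
  assumes r: "r > 0" "r dvd n" and pq: "[q = p] (mod r)"
  obtains \<nu> where "\<nu> \<in> generate (AutoGroup G) {dihedral_phi G a b [^]\<^bsub>AutoGroup G\<^esub> r}"
    "\<nu> (b \<otimes> a [^] p) = b \<otimes> a [^] (q::nat)"
proof -
  \<comment> \<open>As \<open>q\<close> may be smaller than \<open>p\<close>, the natural multiple
    of \<open>r\<close> is taken from coset membership, where the wraparound modulo \<open>n\<close>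
    is already settled.\<close>
  have "b \<otimes> a [^] q \<in> (b \<otimes> a [^] p) <# generate G {a [^] r}"
    using pq refl_mem_coset_iff[OF r] unfolding reflection_coset_def by simp
  then obtain m :: nat where m: "b \<otimes> a [^] q = b \<otimes> a [^] p \<otimes> a [^] (r * m)"
    using generate_pow_on_finite_carrier[OF finite_carrier pow_a_closed, of r] a_closed
    by (auto simp: l_coset_def nat_pow_pow)
  obtain \<nu> where nu: "\<nu> \<in> auto G" "\<nu> a = a [^] (1::nat)" "\<nu> b = b \<otimes> a [^] (r * m)"
    using auto_obtain[of 1] by auto
  have "\<nu> \<in> generate (AutoGroup G) {dihedral_phi G a b [^]\<^bsub>AutoGroup G\<^esub> r}"
    using nu a_closed unfolding generate_phi_pow by auto
  moreover have "\<nu> (b \<otimes> a [^] p) = b \<otimes> a [^] q"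
    unfolding m refl_rot_mult using auto_apply(2)[OF nu] by (simp add: add.commute)
  ultimately show ?thesis by (rule that)
qed

lemma phi_pow_reflection_coset:
  assumes r: "r > 0" "r dvd n"
    and nu: "\<nu> \<in> generate (AutoGroup G) {dihedral_phi G a b [^]\<^bsub>AutoGroup G\<^esub> r}"
  shows "\<nu> ` reflection_coset G a b r i = reflection_coset G a b r i"
proof -
  obtain m where m: "\<nu> \<in> auto G" "\<nu> a = a [^] (1::nat)" "\<nu> b = b \<otimes> a [^] (r * m)"
    using nu a_closed unfolding generate_phi_pow by auto
  have "\<nu> ` reflection_coset G a b r i = reflection_coset G a b r (r * m + 1 * i)"
    using m by (intro auto_reflection_coset[OF r] auto_apply)
  also have "\<dots> = reflection_coset G a b r i"
    by (intro reflection_coset_cong[OF r]) (simp add: cong_def)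
  finally show ?thesis .
qed

text \<open>An automorphism fixing \<open>a\<close> fixes every rotation, and every automorphism
  maps \<open>a\<close> to a rotation; so a conjugate still fixes \<open>a\<close>.\<close>

lemma rotation_automorphisms_normal: "generate (AutoGroup G) {dihedral_phi G a b} \<lhd> AutoGroup G"
proof (rule group.normal_invI[OF AutoGroup])
  show "subgroup (generate (AutoGroup G) {dihedral_phi G a b}) (AutoGroup G)"
    using group.generate_is_subgroup[OF AutoGroup] phi_props(1) by simp
  fix \<sigma> \<nu> assume s: "\<sigma> \<in> carrier (AutoGroup G)"
    and "\<nu> \<in> generate (AutoGroup G) {dihedral_phi G a b}"
  then have s: "\<sigma> \<in> auto G" and nu: "\<nu> \<in> auto G" "\<nu> a = a [^] (1::nat)"
    using a_closed unfolding generate_phi by auto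
  let ?s = "inv\<^bsub>AutoGroup G\<^esub> \<sigma>"
  have s': "?s \<in> auto G" using s by (rule AutoGroup_inv_closed)
  obtain l where l: "?s a = a [^] (l::nat)" using auto_exponents[OF s'] by metis
  obtain j where j: "\<nu> b = b \<otimes> a [^] (j::nat)" using auto_exponents[OF nu(1)] by metis
  have "\<nu> (?s a) = ?s a" unfolding l using auto_apply(1)[OF nu j] by simp
  then have "(\<sigma> \<otimes>\<^bsub>AutoGroup G\<^esub> \<nu> \<otimes>\<^bsub>AutoGroup G\<^esub> ?s) a = a"
    using s s' nu a_closed auto_closed
    by (simp add: AutoGroup_mult_apply AutoGroup_mult_closed AutoGroup_inv_apply)
  then show "\<sigma> \<otimes>\<^bsub>AutoGroup G\<^esub> \<nu> \<otimes>\<^bsub>AutoGroup G\<^esub> ?s \<in> generate (AutoGroup G) {dihedral_phi G a b}"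
    unfolding generate_phi using s s' nu by (simp add: AutoGroup_mult_closed)
qed

text \<open>Stability under \<phi>^r makes membership of a reflection in \<open>C\<close> depend
  only on its exponent modulo \<open>r\<close>, so the exponents below \<open>r\<close> describe all
  of \<open>C\<close>. Transitivity on blocks is inherited from transitivity on elements. The
  explicit \<open>I\<close> serves to recognise later when it contains 0.\<close>

lemma coset_structure:
  assumes r: "r > 0" "r dvd n" and C: "C \<in> transitive_gensets G"
    and A: "Aut_on G C \<inter> generate (AutoGroup G) {dihedral_phi G a b}
      = generate (AutoGroup G) {dihedral_phi G a b [^]\<^bsub>AutoGroup G\<^esub> r}"
  defines "I \<equiv> {i. i < r \<and> b \<otimes> a [^] i \<in> C}"
  shows "reflection_index_set G a b r C I"
    and "aut_factor_transitive_on G (Aut_on G C)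
      (generate (AutoGroup G) {dihedral_phi G a b [^]\<^bsub>AutoGroup G\<^esub> r}) (reflection_coset G a b r ` I)"
proof -
  let ?N = "generate (AutoGroup G) {dihedral_phi G a b [^]\<^bsub>AutoGroup G\<^esub> r}"
  note Cs = transitive_gensets_generating[OF C]
  have shift: "b \<otimes> a [^] q \<in> C" if pC: "b \<otimes> a [^] p \<in> C" and qp: "[q = p] (mod r)" for p q :: nat
  proof -
    obtain \<nu> where nu: "\<nu> \<in> ?N" "\<nu> (b \<otimes> a [^] p) = b \<otimes> a [^] q"
      by (rule shift_reflection[OF r qp])
    then have "\<nu> ` C = C" using A by (auto simp: Aut_on_def)
    then show ?thesis using pC nu(2) by (metis imageI)
  qed
  have mod_I: "p mod r \<in> I" if "b \<otimes> a [^] p \<in> C" for p :: nat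
    using shift[OF that, of "p mod r"] r by (simp add: I_def cong_def)
  have coset_mod: "reflection_coset G a b r p \<in> reflection_coset G a b r ` I"
    if "b \<otimes> a [^] p \<in> C" for p :: nat
  proof -
    have "reflection_coset G a b r p = reflection_coset G a b r (p mod r)"
      by (intro reflection_coset_cong[OF r]) (simp add: cong_def)
    then show ?thesis using mod_I[OF that] by blast
  qed
  have "C = (\<Union>i\<in>I. reflection_coset G a b r i)"
  proof (intro equalityI subsetI)
    fix x assume x: "x \<in> C"
    then obtain p where p: "x = b \<otimes> a [^] (p::nat)" using transitive_gensets_refl[OF C] by blast
    have "x \<in> reflection_coset G a b r (p mod r)"
      unfolding p refl_mem_coset_iff[OF r] by (simp add: cong_def)
    then show "x \<in> (\<Union>i\<in>I. reflection_coset G a b r i)" using mod_I x p by blast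
  next
    fix x assume "x \<in> (\<Union>i\<in>I. reflection_coset G a b r i)"
    then obtain i where i: "i \<in> I" "x \<in> reflection_coset G a b r i" by blast
    then obtain q where q: "x = b \<otimes> a [^] (q::nat)" "[q = i] (mod r)"
      unfolding reflection_coset_eq[OF r] by blast
    have "b \<otimes> a [^] i \<in> C" using i(1) by (simp add: I_def)
    then show "x \<in> C" unfolding q(1) using q(2) by (rule shift)
  qed
  moreover from this have "I \<noteq> {}" using Cs(1) by auto
  ultimately show "reflection_index_set G a b r C I"
    unfolding reflection_index_set_def by (auto simp: I_def)
  show "aut_factor_transitive_on G (Aut_on G C) ?N (reflection_coset G a b r ` I)"
  proof (rule aut_factor_transitive_onI)
    show sub: "subgroup (Aut_on G C) (AutoGroup G)" using Cs(2) by (rule subgroup_Aut_on)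
    \<comment> \<open>By the hypothesis on \<open>r\<close>, \<open>?N\<close> is the intersection
      of the stabiliser with a normal subgroup of the whole automorphism group.\<close>
    show "?N \<lhd> aut_subgroup G (Aut_on G C)"
      using group.normal_Int_subgroup[OF AutoGroup sub rotation_automorphisms_normal] A
      by (simp add: Int_commute)
  next
    fix E assume "E \<in> reflection_coset G a b r ` I"
    then obtain i where i: "i \<in> I" "E = reflection_coset G a b r i" by blast
    show "E \<subseteq> carrier G" unfolding i by (rule reflection_coset_subset[OF r])
    show "\<nu> ` E = E" if "\<nu> \<in> ?N" for \<nu>
      unfolding i using that by (rule phi_pow_reflection_coset[OF r])
    fix \<sigma> assume "\<sigma> \<in> Aut_on G C"
    then have s: "\<sigma> \<in> auto G" "\<sigma> ` C = C" by (auto simp: Aut_on_def)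
    obtain j where j: "\<sigma> (b \<otimes> a [^] i) = b \<otimes> a [^] (j::nat)" by (rule auto_refl[OF s(1)])
    have "b \<otimes> a [^] i \<in> C" using i(1) by (simp add: I_def)
    then have "b \<otimes> a [^] j \<in> C" using j s(2) by (metis imageI)
    then show "\<sigma> ` E \<in> reflection_coset G a b r ` I"
      unfolding i auto_reflection_coset[OF r s(1) j] by (rule coset_mod)
  next
    fix E F assume "E \<in> reflection_coset G a b r ` I" "F \<in> reflection_coset G a b r ` I"
    then obtain i j where ij: "i \<in> I" "j \<in> I"
      and EF: "E = reflection_coset G a b r i" "F = reflection_coset G a b r j" by blast
    have "b \<otimes> a [^] i \<in> C" "b \<otimes> a [^] j \<in> C" using ij by (simp_all add: I_def)
    then obtain \<sigma> where s: "\<sigma> \<in> Aut_on G C" "\<sigma> (b \<otimes> a [^] i) = b \<otimes> a [^] j"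
      by (rule transitive_gensets_trans[OF C])
    then have "\<sigma> ` E = F" unfolding EF by (intro auto_reflection_coset[OF r]) (simp_all add: Aut_on_def)
    then show "\<exists>\<sigma>\<in>Aut_on G C. \<sigma> ` E = F" using s(1) by blast
  qed
qed

section \<open>Moving a block to index zero, claim (b)\<close>

text \<open>Both automorphisms merely add constants to the exponents of reflections.\<close>

lemma rotation_automorphism_commute:
  assumes "\<sigma> \<in> auto G" "\<sigma> a = a" "\<alpha> \<in> auto G" "\<alpha> a = a"
  shows "\<sigma> \<otimes>\<^bsub>AutoGroup G\<^esub> \<alpha> = \<alpha> \<otimes>\<^bsub>AutoGroup G\<^esub> \<sigma>"
proof -
  obtain i j where ij: "\<sigma> b = b \<otimes> a [^] (i::nat)" "\<alpha> b = b \<otimes> a [^] (j::nat)"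
    using auto_exponents assms(1,3) by metis
  have "\<sigma> a = a [^] (1::nat)" "\<alpha> a = a [^] (1::nat)" using assms a_closed by simp_all
  then have "\<sigma> (\<alpha> b) = \<alpha> (\<sigma> b)"
    using auto_apply(2)[OF assms(1) _ ij(1), of 1 j] auto_apply(2)[OF assms(3) _ ij(2), of 1 i] ij
    by (simp add: add.commute)
  then show ?thesis
    using assms a_closed b_closed
    by (intro auto_eqI) (simp_all add: AutoGroup_mult_closed AutoGroup_mult_apply)
qed

text \<open>This guarantees that the shifted set has the same \<open>r\<close>; commuting with
  \<sigma> lets \<alpha> pass through to \<open>C\<close>.\<close>

lemma Aut_on_image_Int_generate_phi:
  assumes s: "\<sigma> \<in> auto G" "\<sigma> a = a" and C: "C \<subseteq> carrier G"
  shows "Aut_on G (\<sigma> ` C) \<inter> generate (AutoGroup G) {dihedral_phi G a b}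
    = Aut_on G C \<inter> generate (AutoGroup G) {dihedral_phi G a b}"
proof -
  have "\<alpha> ` \<sigma> ` C = \<sigma> ` C \<longleftrightarrow> \<alpha> ` C = C" if al: "\<alpha> \<in> auto G" "\<alpha> a = a" for \<alpha>
  proof -
    have "\<alpha> ` \<sigma> ` C = \<sigma> ` \<alpha> ` C"
      using rotation_automorphism_commute[OF s al] AutoGroup_mult_image s al C by metis
    moreover have "\<sigma> ` \<alpha> ` C = \<sigma> ` C \<longleftrightarrow> \<alpha> ` C = C"
      by (rule inj_on_image_eq_iff[OF bij_betw_imp_inj_on[OF auto_bij[OF s(1)]]
            auto_image_subset[OF al(1) C] C])
    ultimately show ?thesis by simp
  qed
  then show ?thesis unfolding generate_phi Aut_on_def by blast
qed

lemma coset_structure_shifted: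
  assumes r: "r > 0" "r dvd n" and C: "C \<in> transitive_gensets G"
    and A: "Aut_on G C \<inter> generate (AutoGroup G) {dihedral_phi G a b}
      = generate (AutoGroup G) {dihedral_phi G a b [^]\<^bsub>AutoGroup G\<^esub> r}"
  shows "\<exists>\<sigma>\<in>auto G.
    Aut_on G (\<sigma> ` C) \<inter> generate (AutoGroup G) {dihedral_phi G a b}
      = generate (AutoGroup G) {dihedral_phi G a b [^]\<^bsub>AutoGroup G\<^esub> r} \<and>
    (\<exists>I. 0 \<in> I \<and> reflection_index_set G a b r (\<sigma> ` C) I \<and>
      aut_factor_transitive_on G (Aut_on G (\<sigma> ` C))
        (generate (AutoGroup G) {dihedral_phi G a b [^]\<^bsub>AutoGroup G\<^esub> r})
        (reflection_coset G a b r ` I))"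
proof -
  note Cs = transitive_gensets_generating[OF C]
  obtain i where i: "b \<otimes> a [^] (i::nat) \<in> C" by (rule generating_set_has_reflection[OF Cs(2,3)])
  \<comment> \<open>The exponent \<open>(n - 1) * i\<close> represents -i, so \<sigma> carries the
    chosen reflection to \<open>b\<close> while fixing \<open>a\<close>.\<close>
  obtain \<sigma> where s: "\<sigma> \<in> auto G" "\<sigma> a = a [^] (1::nat)" "\<sigma> b = b \<otimes> a [^] ((n - 1) * i)"
    by (rule auto_obtain[of 1 "(n - 1) * i"]) simp_all
  have "\<sigma> (b \<otimes> a [^] i) = b \<otimes> a [^] (0::nat)"
    unfolding auto_apply(2)[OF s] refl_eq_iff using pred_mult_add_cong[of i i] by simp
  then have zero: "b \<otimes> a [^] (0::nat) \<in> \<sigma> ` C" using i by (metis imageI)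
  have A': "Aut_on G (\<sigma> ` C) \<inter> generate (AutoGroup G) {dihedral_phi G a b}
      = generate (AutoGroup G) {dihedral_phi G a b [^]\<^bsub>AutoGroup G\<^esub> r}"
    using Aut_on_image_Int_generate_phi[OF s(1) _ Cs(2)] s(2) a_closed A by simp
  note str = coset_structure[OF r auto_image_transitive_gensets[OF C s(1)] A']
  show ?thesis
    using s(1) A' str zero r(1) by (intro bexI[of _ \<sigma>] conjI exI) auto
qed

section \<open>A single block, claim (c)\<close>

lemma single_coset:
  assumes r: "r > 0" "r dvd n" and C: "C \<in> transitive_gensets G"
    and I: "reflection_index_set G a b r C {0}"
  shows "r = 1" and "C = {b \<otimes> a [^] i | i. i \<le> n - 1}" and "Aut_on G C = auto G"
proof -
  have C0: "C = reflection_coset G a b r 0" using I by (simp add: reflection_index_set_def)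
  have "C \<subseteq> {b \<otimes> a [^] j | j. r dvd j}"
    unfolding C0 reflection_coset_eq[OF r] cong_0_iff by blast
  then show r1: "r = 1"
    using generating_reflections_dvd[OF r(2) _ transitive_gensets_generating(3)[OF C]] by blast
  have Call: "C = range (\<lambda>j::nat. b \<otimes> a [^] j)"
    unfolding C0 reflection_coset_eq[OF r] by (auto simp: r1 cong_def)
  show "C = {b \<otimes> a [^] i | i. i \<le> n - 1}"
  proof (intro equalityI subsetI)
    fix x assume "x \<in> C"
    then obtain j where "x = b \<otimes> a [^] (j::nat)" unfolding Call by blast
    then have "x = b \<otimes> a [^] (j mod n)" by (simp add: refl_eq_iff cong_def)
    moreover have "j mod n \<le> n - 1" using mod_less_divisor[OF n_pos, of j] by linarith
    ultimately show "x \<in> {b \<otimes> a [^] i | i. i \<le> n - 1}" by blast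
  qed (auto simp: Call)
  \<comment> \<open>With \<open>r = 1\<close> all reflection cosets coincide, so the image block can
    only be \<open>C\<close> itself.\<close>
  have "\<sigma> ` C = C" if s: "\<sigma> \<in> auto G" for \<sigma>
  proof -
    obtain j where "\<sigma> (b \<otimes> a [^] (0::nat)) = b \<otimes> a [^] (j::nat)" by (rule auto_refl[OF s])
    then have "\<sigma> ` C = reflection_coset G a b r j"
      unfolding C0 by (rule auto_reflection_coset[OF r s])
    also have "\<dots> = C" unfolding C0 by (rule reflection_coset_cong[OF r]) (simp add: r1)
    finally show ?thesis .
  qed
  then show "Aut_on G C = auto G" by (auto simp: Aut_on_def)
qed

section \<open>Two blocks, claim (d)\<close>

lemma aut_then_tau_phi:
  fixes k i :: nat
  assumes k: "coprime k n"
  defines "\<rho> \<equiv> aut_then G (dihedral_tau G a b k) (dihedral_phi G a b [^]\<^bsub>AutoGroup G\<^esub> i)"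
  shows "\<rho> \<in> auto G" "\<rho> a = a [^] k" "\<rho> b = b \<otimes> a [^] i"
proof -
  note t = tau_props[OF k] and p = phi_pow_props[of i]
  show "\<rho> \<in> auto G" unfolding \<rho>_def aut_then_def using p(1) t(1) by (rule AutoGroup_mult_closed)
  have "(dihedral_phi G a b [^]\<^bsub>AutoGroup G\<^esub> i) (a [^] k) = a [^] (1 * k)"
    using p a_closed by (intro auto_apply(1)) auto
  then show "\<rho> a = a [^] k"
    unfolding \<rho>_def aut_then_def using t p(1) a_closed by (simp add: AutoGroup_mult_apply)
  show "\<rho> b = b \<otimes> a [^] i"
    unfolding \<rho>_def aut_then_def using t p b_closed by (simp add: AutoGroup_mult_apply)
qed

text \<open>The required \<open>k\<close> is the multiplier of an automorphism in the stabiliser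
  that carries \<open>b\<close> to \<open>b \<otimes> a [^] i\<close>; transitivity supplies
  one.\<close>

lemma two_cosets:
  assumes r: "r > 0" "r dvd n" and C: "C \<in> transitive_gensets G"
    and A: "Aut_on G C \<inter> generate (AutoGroup G) {dihedral_phi G a b}
      = generate (AutoGroup G) {dihedral_phi G a b [^]\<^bsub>AutoGroup G\<^esub> r}"
    and i: "i \<noteq> 0" and I: "reflection_index_set G a b r C {0, i}"
  shows "gcd i r = 1"
    and "\<exists>k. 0 < k \<and> k < n \<and> gcd k n = 1 \<and> r dvd k + 1 \<and>
      (let H = generate (AutoGroup G) {dihedral_phi G a b [^]\<^bsub>AutoGroup G\<^esub> r,
          aut_then G (dihedral_tau G a b k) (dihedral_phi G a b [^]\<^bsub>AutoGroup G\<^esub> i)}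
       in subgroup H (aut_subgroup G (Aut_on G C)) \<and> aut_transitive_on G H C)"
proof -
  let ?N = "generate (AutoGroup G) {dihedral_phi G a b [^]\<^bsub>AutoGroup G\<^esub> r}"
  note Cs = transitive_gensets_generating[OF C]
  have ir: "i < r" using I by (simp add: reflection_index_set_def)
  have C2: "C = reflection_coset G a b r 0 \<union> reflection_coset G a b r i"
    using I by (simp add: reflection_index_set_def)
  have memC: "b \<otimes> a [^] p \<in> C \<longleftrightarrow> [p = 0] (mod r) \<or> [p = i] (mod r)" for p :: nat
    unfolding C2 Un_iff refl_mem_coset_iff[OF r] by (rule refl)
  have "C \<subseteq> {b \<otimes> a [^] j | j. gcd i r dvd j}"
  proof
    fix x assume x: "x \<in> C"
    then obtain j where j: "x = b \<otimes> a [^] (j::nat)" using transitive_gensets_refl[OF C] by blast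
    \<comment> \<open>Both residues 0 and \<open>i\<close> modulo \<open>r\<close> vanish modulo the
      gcd, so a gcd larger than 1 would contradict generation.\<close>
    have "[j = 0] (mod gcd i r) \<or> [j = i] (mod gcd i r)"
      using x memC unfolding j by (metis cong_dvd_modulus_nat gcd_dvd2)
    then have "gcd i r dvd j" by (auto simp: cong_dvd_iff)
    then show "x \<in> {b \<otimes> a [^] j | j. gcd i r dvd j}" using j by blast
  qed
  moreover have "gcd i r dvd n" using r(2) by (meson dvd_trans gcd_dvd2)
  ultimately show gcd: "gcd i r = 1" using generating_reflections_dvd Cs(3) by blast
  have c: "b \<otimes> a [^] (0::nat) \<in> C" "b \<otimes> a [^] i \<in> C" by (simp_all only: memC cong_refl simp_thms)
  obtain \<sigma> where s: "\<sigma> \<in> Aut_on G C" "\<sigma> (b \<otimes> a [^] (0::nat)) = b \<otimes> a [^] i"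
    by (rule transitive_gensets_trans[OF C c])
  then have sa: "\<sigma> \<in> auto G" and sC: "\<sigma> ` C = C" by (simp_all add: Aut_on_def)
  obtain k j where k: "coprime k n" "0 < k" "k < n" "\<sigma> a = a [^] (k::nat)" "\<sigma> b = b \<otimes> a [^] (j::nat)"
    by (rule auto_exponents[OF sa])
  have sb: "\<sigma> b = b \<otimes> a [^] i" using s(2) b_closed by simp
  note ap = auto_apply[OF sa k(4) sb]
  \<comment> \<open>Otherwise both blocks would be mapped onto the second one and would coincide by
    injectivity, although \<open>0 < i < r\<close>.\<close>
  have "\<not> [i + k * i = i] (mod r)"
  proof
    assume "[i + k * i = i] (mod r)"
    then have "\<sigma> ` reflection_coset G a b r i = reflection_coset G a b r i"
      using auto_reflection_coset[OF r sa ap(2)[of i]] reflection_coset_cong[OF r] by simp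
    moreover have "\<sigma> ` reflection_coset G a b r 0 = reflection_coset G a b r i"
      by (rule auto_reflection_coset[OF r sa s(2)])
    ultimately have "reflection_coset G a b r 0 = reflection_coset G a b r i"
      using inj_on_image_eq_iff[OF bij_betw_imp_inj_on[OF auto_bij[OF sa]]]
        reflection_coset_subset[OF r] by metis
    then have "[0 = i] (mod r)"
      using refl_mem_coset_iff[OF r, of 0 0] refl_mem_coset_iff[OF r, of 0 i] by simp
    then show False using i ir by (simp add: cong_def)
  qed
  moreover have "b \<otimes> a [^] (i + k * i) \<in> C" using c(2) sC ap(2)[of i] by (metis imageI)
  ultimately have ki: "[i + k * i = 0] (mod r)" using memC by blast
  then have "r dvd i * (k + 1)" by (simp add: cong_0_iff algebra_simps)
  \<comment> \<open>Here \<open>i\<close> is cancelled, being coprime to \<open>r\<close>.\<close>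
  then have rk: "r dvd k + 1" using gcd by (metis coprime_commute coprime_dvd_mult_right_iff coprime_iff_gcd_eq_1)
  let ?\<rho> = "aut_then G (dihedral_tau G a b k) (dihedral_phi G a b [^]\<^bsub>AutoGroup G\<^esub> i)"
  have rho: "?\<rho> = \<sigma>"
    using aut_then_tau_phi[OF k(1), of i] sa sb k(4) by (intro auto_eqI) simp_all
  define H where "H = generate (AutoGroup G) {dihedral_phi G a b [^]\<^bsub>AutoGroup G\<^esub> r, \<sigma>}"
  have sub: "subgroup (Aut_on G C) (AutoGroup G)" using Cs(2) by (rule subgroup_Aut_on)
  have H: "subgroup H (AutoGroup G)"
    unfolding H_def using group.generate_is_subgroup[OF AutoGroup] phi_pow_props(1) sa by simp
  have phi_A: "dihedral_phi G a b [^]\<^bsub>AutoGroup G\<^esub> r \<in> Aut_on G C"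
    using A by (metis IntD1 generate.incl insertI1)
  have HA: "H \<subseteq> Aut_on G C"
    unfolding H_def using group.generate_subgroup_incl[OF AutoGroup _ sub] phi_A s(1) by simp
  have NH: "?N \<subseteq> H"
    unfolding H_def by (rule group.mono_generate[OF AutoGroup]) simp
  have sH: "\<sigma> \<in> H" unfolding H_def by (rule generate.incl) simp
  have "subgroup H (aut_subgroup G (Aut_on G C))"
    using group.subgroup_incl[OF AutoGroup H sub HA] .
  moreover have "aut_transitive_on G H C"
  proof (rule iffD2[OF aut_transitive_on_iff[OF H Cs(2)]])
    show "\<eta> ` C = C" if "\<eta> \<in> H" for \<eta> using that HA by (auto simp: Aut_on_def)
    show "\<forall>x\<in>C. \<forall>y\<in>C. \<exists>\<eta>\<in>H. \<eta> x = y"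
    proof (intro ballI)
      fix x y assume xy: "x \<in> C" "y \<in> C"
      then obtain p q where pq: "x = b \<otimes> a [^] (p::nat)" "y = b \<otimes> a [^] (q::nat)"
        using transitive_gensets_refl[OF C] by blast
      have p': "[p = 0] (mod r) \<or> [p = i] (mod r)" using xy(1) memC unfolding pq by simp
      have q': "[q = 0] (mod r) \<or> [q = i] (mod r)" using xy(2) memC unfolding pq by simp
      have "[i + k * p = i] (mod r)" if "[p = 0] (mod r)"
        using cong_add[OF cong_refl[of i] cong_mult[OF cong_refl[of k] that]] by simp
      moreover have "[i + k * p = 0] (mod r)" if "[p = i] (mod r)"
        using cong_trans[OF cong_add[OF cong_refl[of i] cong_mult[OF cong_refl[of k] that]] ki] .
      \<comment> \<open>Since \<sigma> swaps the two blocks, \<open>y\<close> lies in the block of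
        \<open>x\<close> or in that of its image under \<sigma>; what remains is a shift inside one
        block.\<close>
      ultimately have "[q = p] (mod r) \<or> [q = i + k * p] (mod r)"
        using p' q' by (metis cong_sym cong_trans)
      then show "\<exists>\<eta>\<in>H. \<eta> x = y"
      proof
        assume "[q = p] (mod r)"
        then obtain \<nu> where "\<nu> \<in> ?N" "\<nu> x = y" unfolding pq by (rule shift_reflection[OF r])
        then show ?thesis using NH by blast
      next
        assume "[q = i + k * p] (mod r)"
        then obtain \<nu> where nu: "\<nu> \<in> ?N" "\<nu> (b \<otimes> a [^] (i + k * p)) = y"
          unfolding pq by (rule shift_reflection[OF r])
        have "(\<nu> \<otimes>\<^bsub>AutoGroup G\<^esub> \<sigma>) x = y"
          using nu ap(2)[of p] xy(1) Cs(2) sa NH HA unfolding pq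
          by (subst AutoGroup_mult_apply) (auto simp: Aut_on_def)
        moreover have "\<nu> \<otimes>\<^bsub>AutoGroup G\<^esub> \<sigma> \<in> H"
          using subgroup.m_closed[OF H _ sH] nu(1) NH by blast
        ultimately show ?thesis by blast
      qed
    qed
  qed
  ultimately have "subgroup H (aut_subgroup G (Aut_on G C)) \<and> aut_transitive_on G H C" ..
  then show "\<exists>k. 0 < k \<and> k < n \<and> gcd k n = 1 \<and> r dvd k + 1 \<and>
      (let H = generate (AutoGroup G) {dihedral_phi G a b [^]\<^bsub>AutoGroup G\<^esub> r,
          aut_then G (dihedral_tau G a b k) (dihedral_phi G a b [^]\<^bsub>AutoGroup G\<^esub> i)}
       in subgroup H (aut_subgroup G (Aut_on G C)) \<and> aut_transitive_on G H C)"
    using k rk unfolding Let_def by (intro exI[of _ k]) (simp add: rho H_def coprime_iff_gcd_eq_1)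
qed

section \<open>The case of exactly two reflections\<close>

text \<open>The elements \<open>b\<close> and \<open>b \<otimes> a\<close> generate the group, so a
  stabilising automorphism is determined by how it permutes them. The swap is realised by \<rho>,
  which inverts \<open>a\<close> and sends \<open>b\<close> to \<open>b \<otimes> a\<close>.\<close>

lemma Aut_on_two_reflections:
  defines "\<rho> \<equiv> aut_then G (dihedral_tau G a b (n - 1)) (dihedral_phi G a b)"
  shows "Aut_on G {b, b \<otimes> a} = generate (AutoGroup G) {\<rho>}"
    and "aut_subgroup G (Aut_on G {b, b \<otimes> a}) \<cong> integer_mod_group 2"
proof -
  interpret A: group "AutoGroup G" by (rule AutoGroup)
  have cop: "coprime (n - 1) n" using n_pos coprime_diff_one_left_nat by blast
  have phi1: "dihedral_phi G a b [^]\<^bsub>AutoGroup G\<^esub> (1::nat) = dihedral_phi G a b"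
    using phi_props(1) by simp
  have "inv a = a [^] (n - 1)"
    using n_pos a_closed a_pow_n by (intro inv_equality) (simp_all flip: nat_pow_Suc)
  then have rho: "\<rho> \<in> auto G" "\<rho> a = inv a" "\<rho> b = b \<otimes> a"
    using aut_then_tau_phi[OF cop, of 1, unfolded phi1, folded \<rho>_def] a_closed by simp_all
  interpret h: group_hom G G \<rho> using rho(1) by (rule auto_hom)
  have rho_ba: "\<rho> (b \<otimes> a) = b"
    using rho a_closed b_closed by (simp add: m_assoc)
  have "\<not> [1 = 0] (mod n)" using n_ge_3 by (simp add: cong_def)
  then have ba: "b \<otimes> a \<noteq> b" using refl_eq_iff[of 1 0] a_closed b_closed by simp
  have sq: "\<rho> \<otimes>\<^bsub>AutoGroup G\<^esub> \<rho> = \<one>\<^bsub>AutoGroup G\<^esub>"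
  proof (rule auto_eqI)
    show "\<one>\<^bsub>AutoGroup G\<^esub> \<in> auto G" using id_in_auto by (simp add: AutoGroup_one)
    have "\<rho> (\<rho> a) = a" using rho a_closed by simp
    then show "(\<rho> \<otimes>\<^bsub>AutoGroup G\<^esub> \<rho>) a = \<one>\<^bsub>AutoGroup G\<^esub> a"
      using rho a_closed by (simp add: AutoGroup_mult_apply AutoGroup_one)
    show "(\<rho> \<otimes>\<^bsub>AutoGroup G\<^esub> \<rho>) b = \<one>\<^bsub>AutoGroup G\<^esub> b"
      using rho rho_ba b_closed by (simp add: AutoGroup_mult_apply AutoGroup_one)
  qed (use rho AutoGroup_mult_closed in simp)
  have one: "\<rho> \<noteq> \<one>\<^bsub>AutoGroup G\<^esub>" using rho(3) ba b_closed by (auto simp: AutoGroup_one)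
  have eq: "Aut_on G {b, b \<otimes> a} = {\<one>\<^bsub>AutoGroup G\<^esub>, \<rho>}"
  proof (intro equalityI subsetI)
    fix \<alpha> assume "\<alpha> \<in> Aut_on G {b, b \<otimes> a}"
    then have al: "\<alpha> \<in> auto G" "{\<alpha> b, \<alpha> (b \<otimes> a)} = {b, b \<otimes> a}" by (simp_all add: Aut_on_def)
    interpret al: group_hom G G \<alpha> using al(1) by (rule auto_hom)
    have cl: "\<alpha> a \<in> carrier G" using al(1) a_closed by (rule auto_closed)
    from al(2) have "\<alpha> b = b \<and> \<alpha> (b \<otimes> a) = b \<otimes> a \<or> \<alpha> b = b \<otimes> a \<and> \<alpha> (b \<otimes> a) = b"
      using ba by (auto simp: doubleton_eq_iff)
    then show "\<alpha> \<in> {\<one>\<^bsub>AutoGroup G\<^esub>, \<rho>}"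
    proof (elim disjE conjE)
      assume 1: "\<alpha> b = b" "\<alpha> (b \<otimes> a) = b \<otimes> a"
      then have "\<alpha> a = a" using a_closed b_closed cl by simp
      then have "\<alpha> = \<one>\<^bsub>AutoGroup G\<^esub>"
        using al(1) 1 a_closed b_closed id_in_auto by (intro auto_eqI) (simp_all add: AutoGroup_one)
      then show ?thesis by simp
    next
      assume 2: "\<alpha> b = b \<otimes> a" "\<alpha> (b \<otimes> a) = b"
      \<comment> \<open>Expanding the image of \<open>b \<otimes> a\<close> and cancelling
        \<open>b\<close> shows that a swapping automorphism must invert \<open>a\<close>.\<close>
      then have "b \<otimes> (a \<otimes> \<alpha> a) = b \<otimes> \<one>" using a_closed b_closed cl by (simp add: m_assoc)
      then have "a \<otimes> \<alpha> a = \<one>" using a_closed b_closed cl by simp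
      then have "\<alpha> a = inv a" using inv_comm[of a "\<alpha> a"] inv_equality[of "\<alpha> a" a] a_closed cl by simp
      then have "\<alpha> a = \<rho> a" "\<alpha> b = \<rho> b" by (simp_all only: rho 2(1))
      with al(1) rho(1) have "\<alpha> = \<rho>" by (rule auto_eqI)
      then show ?thesis by simp
    qed
  next
    fix \<alpha> assume "\<alpha> \<in> {\<one>\<^bsub>AutoGroup G\<^esub>, \<rho>}"
    then show "\<alpha> \<in> Aut_on G {b, b \<otimes> a}"
      using rho rho_ba id_in_auto a_closed b_closed by (auto simp: Aut_on_def AutoGroup_one)
  qed
  show "Aut_on G {b, b \<otimes> a} = generate (AutoGroup G) {\<rho>}"
    using group.generate_involution[OF AutoGroup _ sq] rho(1) eq by simp
  show "aut_subgroup G (Aut_on G {b, b \<otimes> a}) \<cong> integer_mod_group 2"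
    unfolding eq using group.involution_subgroup_iso[OF AutoGroup _ sq one] rho(1) by simp
qed

text \<open>For \<open>r = n\<close> the blocks are singletons, and since \<open>i\<close> is a unit
  modulo \<open>n\<close> it can be rescaled to 1.\<close>

lemma two_reflections:
  assumes C: "C \<in> transitive_gensets G" and cop: "gcd i n = 1"
    and I: "reflection_index_set G a b n C {0, i}"
  obtains \<sigma> where "\<sigma> \<in> auto G" "\<sigma> ` C = {b, b \<otimes> a}"
proof -
  have C2: "C = {b, b \<otimes> a [^] i}"
  proof -
    have "reflection_coset G a b n j = {b \<otimes> a [^] j}" for j
      unfolding reflection_coset_eq[OF n_pos dvd_refl] refl_eq_iff[symmetric] by auto
    then show ?thesis using I b_closed by (auto simp: reflection_index_set_def)
  qed
  \<comment> \<open>The inverse of \<open>i\<close> modulo \<open>n\<close> is the multiplier: the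
    corresponding \<tau> fixes \<open>b\<close> and sends exponent \<open>i\<close> to 1.\<close>
  obtain l where l: "[i * l = 1] (mod n)"
    using cop cong_solve_coprime_nat[of i n] by (auto simp: coprime_iff_gcd_eq_1)
  then have "coprime l n"
    unfolding coprime_iff_invertible_nat by (auto simp: mult.commute)
  from tau_props[OF this] obtain \<sigma> where s: "\<sigma> \<in> auto G" "\<sigma> a = a [^] l" "\<sigma> b = b \<otimes> a [^] (0::nat)"
    using b_closed by auto
  have "\<sigma> (b \<otimes> a [^] i) = b \<otimes> a [^] (1::nat)"
    unfolding auto_apply(2)[OF s] refl_eq_iff using l by (simp add: mult.commute)
  then have "\<sigma> ` C = {b, b \<otimes> a}" unfolding C2 using s a_closed b_closed by simp
  with s(1) show ?thesis by (rule that)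
qed

end

section \<open>Assembly of the four claims\<close>

text \<open>The phrase "we may assume" in claim (b) becomes the existence of a \<sigma> for which
  the intersection with the group generated by \<phi>, and hence \<open>r\<close>, is unchanged.
  Claims (c) and (d) therefore apply to the shifted set as they stand.\<close>

theorem theorem4p1:
  fixes G (structure) and a b :: 'g and n r :: nat
    and C :: "'g set" and A\<^sub>0 :: "('g \<Rightarrow> 'g) set"
    and \<phi> :: "'g \<Rightarrow> 'g" and \<tau> :: "nat \<Rightarrow> 'g \<Rightarrow> 'g"
  assumes n: "n \<ge> 3"
    and G: "dihedral_group G n a b"
    and \<phi>: "\<phi> = dihedral_phi G a b"
    and \<tau>: "\<tau> = dihedral_tau G a b"
    and C: "C \<in> transitive_gensets G"
    and A\<^sub>0: "A\<^sub>0 = Aut_on G C"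
    and r: "r > 0" "r dvd n"
    and A\<^sub>0_\<phi>: "A\<^sub>0 \<inter> generate (AutoGroup G) {\<phi>} = generate (AutoGroup G) {\<phi> [^]\<^bsub>AutoGroup G\<^esub> r}"
  shows
     "(\<exists>I. reflection_index_set G a b r C I \<and>
        aut_factor_transitive_on G A\<^sub>0 (generate (AutoGroup G) {\<phi> [^]\<^bsub>AutoGroup G\<^esub> r})
          (reflection_coset G a b r ` I)) \<and>
      ((\<forall>\<sigma>\<in>auto G. \<sigma> ` C \<in> transitive_gensets G) \<and>
        (\<exists>\<sigma>\<in>auto G.
           Aut_on G (\<sigma> ` C) \<inter> generate (AutoGroup G) {\<phi>}
             = generate (AutoGroup G) {\<phi> [^]\<^bsub>AutoGroup G\<^esub> r} \<and>
           (\<exists>I. 0 \<in> I \<and> reflection_index_set G a b r (\<sigma> ` C) I \<and>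
              aut_factor_transitive_on G (Aut_on G (\<sigma> ` C))
                (generate (AutoGroup G) {\<phi> [^]\<^bsub>AutoGroup G\<^esub> r})
                (reflection_coset G a b r ` I)))) \<and>
      (reflection_index_set G a b r C {0} \<longrightarrow>
        r = 1 \<and>
        C = {b \<otimes> a [^] i | i. i \<le> n - 1} \<and>
        C = {x \<in> carrier G. group.ord G x = 2 \<and> (\<exists>y\<in>carrier G. x \<otimes> y \<noteq> y \<otimes> x)} \<and>
        A\<^sub>0 = auto G) \<and>
      (\<forall>i. i \<noteq> 0 \<longrightarrow> reflection_index_set G a b r C {0, i} \<longrightarrow>
        gcd i r = 1 \<and>
        (\<exists>k. 0 < k \<and> k < n \<and> gcd k n = 1 \<and> r dvd k + 1 \<and>
           C = (b <# generate G {a [^] r}) \<union> ((b \<otimes> a [^] i) <# generate G {a [^] r}) \<and>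
           (let H = generate (AutoGroup G)
                      {\<phi> [^]\<^bsub>AutoGroup G\<^esub> r, aut_then G (\<tau> k) (\<phi> [^]\<^bsub>AutoGroup G\<^esub> i)}
            in subgroup H (aut_subgroup G A\<^sub>0) \<and> aut_transitive_on G H C)) \<and>
        (r = n \<longrightarrow>
           (\<exists>\<sigma>\<in>auto G.
              \<sigma> ` C = {b, b \<otimes> a} \<and>
              aut_conj G A\<^sub>0 \<sigma> = generate (AutoGroup G) {aut_then G (\<tau> (n - 1)) \<phi>} \<and>
              aut_subgroup G (aut_conj G A\<^sub>0 \<sigma>) \<cong> integer_mod_group 2)))"
proof -
  interpret dihedral_group_ge_3 G n a b
    using G n by (intro dihedral_group_ge_3.intro dihedral_group_ge_3_axioms.intro)
  note A = A\<^sub>0_\<phi>[unfolded A\<^sub>0 \<phi>]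
  note Cs = transitive_gensets_generating[OF C]
  have c: "r = 1 \<and> C = {b \<otimes> a [^] i | i. i \<le> n - 1} \<and>
      C = {x \<in> carrier G. ord x = 2 \<and> (\<exists>y\<in>carrier G. x \<otimes> y \<noteq> y \<otimes> x)} \<and> A\<^sub>0 = auto G"
    if I: "reflection_index_set G a b r C {0}"
    unfolding noncentral_involutions A\<^sub>0 using single_coset[OF r C I] by (intro conjI)
  have d: "gcd i r = 1 \<and>
      (\<exists>k. 0 < k \<and> k < n \<and> gcd k n = 1 \<and> r dvd k + 1 \<and>
         C = (b <# generate G {a [^] r}) \<union> ((b \<otimes> a [^] i) <# generate G {a [^] r}) \<and>
         (let H = generate (AutoGroup G)
                    {\<phi> [^]\<^bsub>AutoGroup G\<^esub> r, aut_then G (\<tau> k) (\<phi> [^]\<^bsub>AutoGroup G\<^esub> i)}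
          in subgroup H (aut_subgroup G A\<^sub>0) \<and> aut_transitive_on G H C)) \<and>
      (r = n \<longrightarrow>
         (\<exists>\<sigma>\<in>auto G.
            \<sigma> ` C = {b, b \<otimes> a} \<and>
            aut_conj G A\<^sub>0 \<sigma> = generate (AutoGroup G) {aut_then G (\<tau> (n - 1)) \<phi>} \<and>
            aut_subgroup G (aut_conj G A\<^sub>0 \<sigma>) \<cong> integer_mod_group 2))"
    if i: "i \<noteq> 0" and I: "reflection_index_set G a b r C {0, i}" for i
  proof (intro conjI impI)
    note two = two_cosets[OF r C A i I]
    show gcd: "gcd i r = 1" by (rule two(1))
    have C2: "C = (b <# generate G {a [^] r}) \<union> ((b \<otimes> a [^] i) <# generate G {a [^] r})"
      using I b_closed by (simp add: reflection_index_set_def reflection_coset_def)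
    obtain k where k: "0 < k \<and> k < n \<and> gcd k n = 1 \<and> r dvd k + 1 \<and>
      (let H = generate (AutoGroup G) {dihedral_phi G a b [^]\<^bsub>AutoGroup G\<^esub> r,
          aut_then G (dihedral_tau G a b k) (dihedral_phi G a b [^]\<^bsub>AutoGroup G\<^esub> i)}
       in subgroup H (aut_subgroup G (Aut_on G C)) \<and> aut_transitive_on G H C)"
      using two(2) by (elim exE)
    show "\<exists>k. 0 < k \<and> k < n \<and> gcd k n = 1 \<and> r dvd k + 1 \<and>
         C = (b <# generate G {a [^] r}) \<union> ((b \<otimes> a [^] i) <# generate G {a [^] r}) \<and>
         (let H = generate (AutoGroup G)
                    {\<phi> [^]\<^bsub>AutoGroup G\<^esub> r, aut_then G (\<tau> k) (\<phi> [^]\<^bsub>AutoGroup G\<^esub> i)}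
          in subgroup H (aut_subgroup G A\<^sub>0) \<and> aut_transitive_on G H C)"
      using k C2 unfolding \<phi> \<tau> A\<^sub>0 by (intro exI[of _ k] conjI) (elim conjE; assumption)+
    assume rn: "r = n"
    obtain \<sigma> where s: "\<sigma> \<in> auto G" "\<sigma> ` C = {b, b \<otimes> a}"
      using two_reflections[OF C gcd[unfolded rn] I[unfolded rn]] .
    \<comment> \<open>The conjugated stabiliser is the stabiliser of the image, which reduces the
      claim to the standard pair.\<close>
    have "aut_conj G A\<^sub>0 \<sigma> = Aut_on G {b, b \<otimes> a}"
      unfolding A\<^sub>0 aut_conj_Aut_on[OF s(1) Cs(2)] s(2) ..
    then show "\<exists>\<sigma>\<in>auto G.
            \<sigma> ` C = {b, b \<otimes> a} \<and>
            aut_conj G A\<^sub>0 \<sigma> = generate (AutoGroup G) {aut_then G (\<tau> (n - 1)) \<phi>} \<and>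
            aut_subgroup G (aut_conj G A\<^sub>0 \<sigma>) \<cong> integer_mod_group 2"
      using s Aut_on_two_reflections unfolding \<phi> \<tau> by (intro bexI[of _ \<sigma>] conjI) simp_all
  qed
  have conj: "\<forall>\<sigma>\<in>auto G. \<sigma> ` C \<in> transitive_gensets G"
    using auto_image_transitive_gensets[OF C] by (rule ballI)
  show ?thesis
    unfolding \<phi> A\<^sub>0
    by (rule conjI, rule exI, rule conjI[OF coset_structure[OF r C A]],
        rule conjI[OF conjI[OF conj coset_structure_shifted[OF r C A]]],
        rule conjI, rule impI, erule c[unfolded A\<^sub>0],
        intro allI impI, erule (1) d[unfolded \<phi> A\<^sub>0])
qed

end
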